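(* Let $(M^3,\varphi,\xi,\eta,g)$ be a connected complete non-Sasakian contact metric three-manifold satisfying $Q\xi=\sigma\xi$, where $Q$ is the Ricci operator and $\sigma$ is a constant. Suppose that $g$ admits an almost Ricci--Bourguignon soliton $$\operatorname{Ric}+\tfrac12\mathcal{L}_Vg=(\lambda+\rho r)g$$ (with $V$ a smooth vector field on $M$, $\lambda$ a smooth function on $M$, $\rho\in\mathbb{R}$ a constant, and $r$ the scalar curvature) whose potential vector field is orthogonal to the Reeb vector field, that is, $g(V,\xi)=0$. Then $$\lambda+\rho r=\sigma.$$ In particular, $\lambda$ is constant, so the almost Ricci--Bourguignon soliton reduces to a Ricci--Bourguignon soliton. Moreover, $M$ is Einstein. If $V$ is not identically zero, then $M$ is flat.
   Context: A contact metric manifold $(M^{2n+1},\varphi,\xi,\eta,g)$ is a Riemannian manifold $(M,g)$ with a global 1-form $\eta$ satisfying $\eta\wedge(d\eta)^n\neq0$ everywhere, a unit vector field $\xi$ (the Reeb vector field) with $\eta(\xi)=1$ and $d\eta(\xi,\cdot)=0$, and a $(1,1)$-tensor field $\varphi$ with $d\eta(X,Y)=g(X,\varphi Y)$, $\eta(X)=g(X,\xi)$, $\varphi^2X=-X+\eta(X)\xi$. The normalization is $d\eta(X,Y)=\frac12\{X\eta(Y)-Y\eta(X)-\eta([X,Y])\}$, so that $\nabla_X\xi=-\varphi X-\varphi hX$, where $\nabla$ is the Levi-Civita connection and $h=\frac12\mathcal{L}_\xi\varphi$. The manifold is Sasakian if $(\nabla_X\varphi)Y=g(X,Y)\xi-\eta(Y)X$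 for all $X,Y$; in dimension 3 this is equivalent to $h=0$ everywhere. Non-Sasakian means not Sasakian. The Ricci operator $Q$ is defined by $\operatorname{Ric}(X,Y)=g(QX,Y)$. A Ricci--Bourguignon soliton is an almost Ricci--Bourguignon soliton whose soliton function $\lambda$ is constant. $\mathcal{L}_Vg$ is the Lie derivative of $g$ along $V$. *)

theory Defs
  imports "HOL-Analysis.Analysis" "HOL-Library.Function_Algebras"
begin

section \<open>Smooth manifolds\<close>

text \<open>
  A manifold is a whole type \<open>'a\<close> (Hausdorff and second countable as a type class
  constraint in the theorem) with a smooth atlas of charts \<open>(W, x)\<close>, where \<open>x\<close> is only
  relevant on the open set \<open>W\<close>. The atlas need not be maximal.
\<close>

type_synonym ('a, 'n) atlas = "('a set \<times> ('a \<Rightarrow> real ^ 'n)) set"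

primrec Ck_on :: "nat \<Rightarrow> 'b::real_normed_vector set \<Rightarrow> ('b \<Rightarrow> 'c::real_normed_vector) \<Rightarrow> bool" where
  "Ck_on 0 S f \<longleftrightarrow> continuous_on S f"
| "Ck_on (Suc k) S f \<longleftrightarrow>
     (\<forall>x\<in>S. f differentiable (at x)) \<and> (\<forall>v. Ck_on k S (\<lambda>x. frechet_derivative f (at x) v))"

text \<open>Only used for open \<open>S\<close>.\<close>

definition smooth_on :: "'b::real_normed_vector set \<Rightarrow> ('b \<Rightarrow> 'c::real_normed_vector) \<Rightarrow> bool" where
  "smooth_on S f \<longleftrightarrow> (\<forall>k. Ck_on k S f)"

definition smooth_atlas :: "('a::topological_space, 'n::finite) atlas \<Rightarrow> bool" where
  "smooth_atlas A \<longleftrightarrow>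
     (\<Union>(W, x)\<in>A. W) = UNIV \<and>
     (\<forall>(W, x)\<in>A. open W \<and> open (x ` W) \<and> homeomorphism W (x ` W) x (inv_into W x)) \<and>
     (\<forall>(W, x)\<in>A. \<forall>(W', x')\<in>A. smooth_on (x ` (W \<inter> W')) (x' \<circ> inv_into W x))"

text \<open>The ring of smooth functions on the open set \<open>U\<close>.\<close>

definition smooth_funs :: "('a::topological_space, 'n::finite) atlas \<Rightarrow> 'a set \<Rightarrow> ('a \<Rightarrow> real) set" where
  "smooth_funs A U = {f. \<forall>(W, x)\<in>A. smooth_on (x ` (U \<inter> W)) (f \<circ> inv_into W x)}"

definition smooth_near :: "('a::topological_space, 'n::finite) atlas \<Rightarrow> 'a \<Rightarrow> ('a \<Rightarrow> real) \<Rightarrow> bool" where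
  "smooth_near A p f \<longleftrightarrow> (\<exists>U. open U \<and> p \<in> U \<and> f \<in> smooth_funs A U)"

definition smooth_curve :: "('a::topological_space, 'n::finite) atlas \<Rightarrow> real set \<Rightarrow> (real \<Rightarrow> 'a) \<Rightarrow> bool" where
  "smooth_curve A J \<gamma> \<longleftrightarrow>
     open J \<and> continuous_on J \<gamma> \<and> (\<forall>(W, x)\<in>A. smooth_on {t \<in> J. \<gamma> t \<in> W} (x \<circ> \<gamma>))"


section \<open>Tangent vectors and vector fields\<close>

text \<open>
  A tangent vector at \<open>p\<close> is the directional derivative along a smooth curve through \<open>p\<close>,
  acting on the functions that are smooth near \<open>p\<close>. To make it determined as a total
  function it is \<open>0\<close> on all other functions. Addition, subtraction and \<open>0\<close> of tangent
  vectors are the pointwise operations on functions.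
\<close>

type_synonym 'a tvec = "('a \<Rightarrow> real) \<Rightarrow> real"
type_synonym 'a vfield = "'a \<Rightarrow> 'a tvec"

definition tscale :: "real \<Rightarrow> 'a tvec \<Rightarrow> 'a tvec" (infixr "\<cdot>" 75) where
  "c \<cdot> v = (\<lambda>f. c * v f)"

definition velocity :: "('a::topological_space, 'n::finite) atlas \<Rightarrow> (real \<Rightarrow> 'a) \<Rightarrow> real \<Rightarrow> 'a tvec" where
  "velocity A \<gamma> t = (\<lambda>f. if smooth_near A (\<gamma> t) f then deriv (\<lambda>s. f (\<gamma> s)) t else 0)"

definition tangent_space :: "('a::topological_space, 'n::finite) atlas \<Rightarrow> 'a \<Rightarrow> 'a tvec set" where
  "tangent_space A p =
     {velocity A \<gamma> 0 | \<gamma> \<epsilon>. \<epsilon> > 0 \<and> smooth_curve A {-\<epsilon><..<\<epsilon>} \<gamma> \<and> \<gamma> 0 = p}"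

text \<open>The smooth vector fields on the open set \<open>U\<close>; their values outside \<open>U\<close> are irrelevant.\<close>

definition vfields :: "('a::topological_space, 'n::finite) atlas \<Rightarrow> 'a set \<Rightarrow> 'a vfield set" where
  "vfields A U =
     {X. (\<forall>p\<in>U. X p \<in> tangent_space A p) \<and>
         (\<forall>W f. open W \<and> W \<subseteq> U \<and> f \<in> smooth_funs A W \<longrightarrow> (\<lambda>p. X p f) \<in> smooth_funs A W)}"

definition lie_bracket :: "('a::topological_space, 'n::finite) atlas \<Rightarrow> 'a vfield \<Rightarrow> 'a vfield \<Rightarrow> 'a vfield" where
  "lie_bracket A X Y p =
     (\<lambda>f. if smooth_near A p f then X p (\<lambda>q. Y q f) - Y p (\<lambda>q. X q f) else 0)"


section \<open>Tensor fields\<close>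

definition one_form :: "('a::topological_space, 'n::finite) atlas \<Rightarrow> ('a \<Rightarrow> 'a tvec \<Rightarrow> real) \<Rightarrow> bool" where
  "one_form A \<eta> \<longleftrightarrow>
     (\<forall>p. \<forall>u\<in>tangent_space A p. \<forall>v\<in>tangent_space A p. \<forall>c.
        \<eta> p (u + v) = \<eta> p u + \<eta> p v \<and> \<eta> p (c \<cdot> u) = c * \<eta> p u) \<and>
     (\<forall>U. open U \<longrightarrow> (\<forall>X\<in>vfields A U. (\<lambda>p. \<eta> p (X p)) \<in> smooth_funs A U))"

definition endo_field :: "('a::topological_space, 'n::finite) atlas \<Rightarrow> ('a \<Rightarrow> 'a tvec \<Rightarrow> 'a tvec) \<Rightarrow> bool" where
  "endo_field A \<phi> \<longleftrightarrow>
     (\<forall>p. \<forall>u\<in>tangent_space A p. \<phi> p u \<in> tangent_space A p \<and>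
        (\<forall>v\<in>tangent_space A p. \<forall>c. \<phi> p (u + v) = \<phi> p u + \<phi> p v \<and> \<phi> p (c \<cdot> u) = c \<cdot> \<phi> p u)) \<and>
     (\<forall>U. open U \<longrightarrow> (\<forall>X\<in>vfields A U. (\<lambda>p. \<phi> p (X p)) \<in> vfields A U))"

definition riemannian_metric :: "('a::topological_space, 'n::finite) atlas \<Rightarrow> ('a \<Rightarrow> 'a tvec \<Rightarrow> 'a tvec \<Rightarrow> real) \<Rightarrow> bool" where
  "riemannian_metric A g \<longleftrightarrow>
     (\<forall>p. \<forall>u\<in>tangent_space A p.
        (u \<noteq> 0 \<longrightarrow> g p u u > 0) \<and>
        (\<forall>v\<in>tangent_space A p. g p u v = g p v u \<and>
           (\<forall>w\<in>tangent_space A p. \<forall>c.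
              g p (u + v) w = g p u w + g p v w \<and> g p (c \<cdot> u) w = c * g p u w))) \<and>
     (\<forall>U. open U \<longrightarrow> (\<forall>X\<in>vfields A U. \<forall>Y\<in>vfields A U.
        (\<lambda>p. g p (X p) (Y p)) \<in> smooth_funs A U))"

text \<open>
  The exterior derivative of a one-form, with the factor \<open>1/2\<close>; the factor \<open>1/3\<close> in the
  wedge product is the one that goes with this normalization.
\<close>

definition ext_deriv :: "('a::topological_space, 'n::finite) atlas \<Rightarrow> ('a \<Rightarrow> 'a tvec \<Rightarrow> real) \<Rightarrow>
    'a vfield \<Rightarrow> 'a vfield \<Rightarrow> 'a \<Rightarrow> real" where
  "ext_deriv A \<eta> X Y p =
     (1/2) * (X p (\<lambda>q. \<eta> q (Y q)) - Y p (\<lambda>q. \<eta> q (X q)) - \<eta> p (lie_bracket A X Y p))"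

definition wedge_ext_deriv :: "('a::topological_space, 'n::finite) atlas \<Rightarrow> ('a \<Rightarrow> 'a tvec \<Rightarrow> real) \<Rightarrow>
    'a vfield \<Rightarrow> 'a vfield \<Rightarrow> 'a vfield \<Rightarrow> 'a \<Rightarrow> real" where
  "wedge_ext_deriv A \<eta> X Y Z p =
     (1/3) * (\<eta> p (X p) * ext_deriv A \<eta> Y Z p + \<eta> p (Y p) * ext_deriv A \<eta> Z X p
              + \<eta> p (Z p) * ext_deriv A \<eta> X Y p)"

definition lie_deriv_metric :: "('a::topological_space, 'n::finite) atlas \<Rightarrow> ('a \<Rightarrow> 'a tvec \<Rightarrow> 'a tvec \<Rightarrow> real) \<Rightarrow>
    'a vfield \<Rightarrow> 'a vfield \<Rightarrow> 'a vfield \<Rightarrow> 'a \<Rightarrow> real" where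
  "lie_deriv_metric A g V X Y p =
     V p (\<lambda>q. g q (X q) (Y q)) - g p (lie_bracket A V X p) (Y p) - g p (X p) (lie_bracket A V Y p)"


section \<open>Connections and curvature\<close>

text \<open>
  An affine connection operates on the vector fields on every open set. That it is a local
  operator in both arguments is a consequence: multiply a field by a function that is
  \<open>1\<close> on \<open>U\<close> and \<open>0\<close> elsewhere, which belongs to \<open>smooth_funs A U\<close>.
\<close>

definition affine_connection :: "('a::topological_space, 'n::finite) atlas \<Rightarrow>
    ('a vfield \<Rightarrow> 'a vfield \<Rightarrow> 'a vfield) \<Rightarrow> bool" where
  "affine_connection A D \<longleftrightarrow>
     (\<forall>U. open U \<longrightarrow> (\<forall>X\<in>vfields A U. \<forall>Y\<in>vfields A U.
        D X Y \<in> vfields A U \<and>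
        (\<forall>Z\<in>vfields A U. \<forall>p\<in>U.
           D (X + Z) Y p = D X Y p + D Z Y p \<and>
           D X (Y + Z) p = D X Y p + D X Z p) \<and>
        (\<forall>f\<in>smooth_funs A U. \<forall>p\<in>U.
           D (\<lambda>q. f q \<cdot> X q) Y p = f p \<cdot> D X Y p \<and>
           D X (\<lambda>q. f q \<cdot> Y q) p = X p f \<cdot> Y p + f p \<cdot> D X Y p)))"

text \<open>
  The Levi-Civita connection as the torsion-free metric connection. On smooth vector fields
  on \<open>U\<close> the values of \<open>D\<close> at the points of \<open>U\<close> are uniquely determined by these
  conditions; all other values are arbitrary and never used.
\<close>

definition levi_civita :: "('a::topological_space, 'n::finite) atlas \<Rightarrow> ('a \<Rightarrow> 'a tvec \<Rightarrow> 'a tvec \<Rightarrow> real) \<Rightarrow>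
    ('a vfield \<Rightarrow> 'a vfield \<Rightarrow> 'a vfield) \<Rightarrow> bool" where
  "levi_civita A g D \<longleftrightarrow> affine_connection A D \<and>
     (\<forall>U. open U \<longrightarrow> (\<forall>X\<in>vfields A U. \<forall>Y\<in>vfields A U. \<forall>p\<in>U.
        D X Y p - D Y X p = lie_bracket A X Y p \<and>
        (\<forall>Z\<in>vfields A U. X p (\<lambda>q. g q (Y q) (Z q)) = g p (D X Y p) (Z p) + g p (Y p) (D X Z p))))"

definition curvature :: "('a::topological_space, 'n::finite) atlas \<Rightarrow> ('a vfield \<Rightarrow> 'a vfield \<Rightarrow> 'a vfield) \<Rightarrow>
    'a vfield \<Rightarrow> 'a vfield \<Rightarrow> 'a vfield \<Rightarrow> 'a vfield" where
  "curvature A D X Y Z p = D X (D Y Z) p - D Y (D X Z) p - D (lie_bracket A X Y) Z p"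

definition orthonormal_frame_at :: "('a::topological_space, 'n::finite) atlas \<Rightarrow>
    ('a \<Rightarrow> 'a tvec \<Rightarrow> 'a tvec \<Rightarrow> real) \<Rightarrow> 'a \<Rightarrow> ('n \<Rightarrow> 'a vfield) \<Rightarrow> bool" where
  "orthonormal_frame_at A g p E \<longleftrightarrow>
     (\<exists>U. open U \<and> p \<in> U \<and> (\<forall>i. E i \<in> vfields A U) \<and>
        (\<forall>q\<in>U. \<forall>i j. g q (E i q) (E j q) = (if i = j then 1 else 0)))"

text \<open>
  \<open>ricci A g D X Y\<close> is the trace of \<open>Z \<mapsto> R(Z, X) Y\<close>. Traces are computed in some smooth
  local orthonormal frame; they do not depend on the choice.
\<close>

definition ricci :: "('a::topological_space, 'n::finite) atlas \<Rightarrow> ('a \<Rightarrow> 'a tvec \<Rightarrow> 'a tvec \<Rightarrow> real) \<Rightarrow>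
    ('a vfield \<Rightarrow> 'a vfield \<Rightarrow> 'a vfield) \<Rightarrow> 'a vfield \<Rightarrow> 'a vfield \<Rightarrow> 'a \<Rightarrow> real" where
  "ricci A g D X Y p =
     (let E = (SOME E. orthonormal_frame_at A g p E)
      in \<Sum>i\<in>UNIV. g p (curvature A D (E i) X Y p) (E i p))"

definition scalar_curvature :: "('a::topological_space, 'n::finite) atlas \<Rightarrow>
    ('a \<Rightarrow> 'a tvec \<Rightarrow> 'a tvec \<Rightarrow> real) \<Rightarrow> ('a vfield \<Rightarrow> 'a vfield \<Rightarrow> 'a vfield) \<Rightarrow> 'a \<Rightarrow> real" where
  "scalar_curvature A g D p =
     (let E = (SOME E. orthonormal_frame_at A g p E)
      in \<Sum>i\<in>UNIV. ricci A g D (E i) (E i) p)"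

definition ricci_operator :: "('a::topological_space, 'n::finite) atlas \<Rightarrow>
    ('a \<Rightarrow> 'a tvec \<Rightarrow> 'a tvec \<Rightarrow> real) \<Rightarrow> ('a vfield \<Rightarrow> 'a vfield \<Rightarrow> 'a vfield) \<Rightarrow> 'a vfield \<Rightarrow> 'a vfield" where
  "ricci_operator A g D X p =
     (THE v. v \<in> tangent_space A p \<and>
        (\<forall>U. open U \<and> p \<in> U \<longrightarrow> (\<forall>Y\<in>vfields A U. ricci A g D X Y p = g p v (Y p))))"

definition einstein :: "('a::topological_space, 'n::finite) atlas \<Rightarrow>
    ('a \<Rightarrow> 'a tvec \<Rightarrow> 'a tvec \<Rightarrow> real) \<Rightarrow> ('a vfield \<Rightarrow> 'a vfield \<Rightarrow> 'a vfield) \<Rightarrow> bool" where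
  "einstein A g D \<longleftrightarrow>
     (\<exists>c::real. \<forall>U. open U \<longrightarrow> (\<forall>X\<in>vfields A U. \<forall>Y\<in>vfields A U. \<forall>p\<in>U.
        ricci A g D X Y p = c * g p (X p) (Y p)))"

definition flat :: "('a::topological_space, 'n::finite) atlas \<Rightarrow>
    ('a vfield \<Rightarrow> 'a vfield \<Rightarrow> 'a vfield) \<Rightarrow> bool" where
  "flat A D \<longleftrightarrow>
     (\<forall>U. open U \<longrightarrow> (\<forall>X\<in>vfields A U. \<forall>Y\<in>vfields A U. \<forall>Z\<in>vfields A U. \<forall>p\<in>U.
        curvature A D X Y Z p = 0))"


section \<open>Completeness\<close>

text \<open>
  The infimum over smooth curves is the same as over piecewise smooth ones, because
  reparametrization by a function that is flat at the break points makes the latter smooth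
  without changing the length.
\<close>

definition riemannian_dist :: "('a::topological_space, 'n::finite) atlas \<Rightarrow>
    ('a \<Rightarrow> 'a tvec \<Rightarrow> 'a tvec \<Rightarrow> real) \<Rightarrow> 'a \<Rightarrow> 'a \<Rightarrow> real" where
  "riemannian_dist A g p q =
     Inf {integral {0..1} (\<lambda>t. sqrt (g (\<gamma> t) (velocity A \<gamma> t) (velocity A \<gamma> t))) | \<gamma> J.
            {0..1} \<subseteq> J \<and> smooth_curve A J \<gamma> \<and> \<gamma> 0 = p \<and> \<gamma> 1 = q}"

definition complete_riemannian :: "('a::topological_space, 'n::finite) atlas \<Rightarrow>
    ('a \<Rightarrow> 'a tvec \<Rightarrow> 'a tvec \<Rightarrow> real) \<Rightarrow> bool" where
  "complete_riemannian A g \<longleftrightarrow> Metric_space.mcomplete UNIV (riemannian_dist A g)"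


section \<open>Contact metric three-manifolds\<close>

definition contact_metric_3 :: "('a::topological_space, 3) atlas \<Rightarrow> ('a \<Rightarrow> 'a tvec \<Rightarrow> 'a tvec) \<Rightarrow> 'a vfield \<Rightarrow>
    ('a \<Rightarrow> 'a tvec \<Rightarrow> real) \<Rightarrow> ('a \<Rightarrow> 'a tvec \<Rightarrow> 'a tvec \<Rightarrow> real) \<Rightarrow> bool" where
  "contact_metric_3 A \<phi> \<xi> \<eta> g \<longleftrightarrow>
     riemannian_metric A g \<and> one_form A \<eta> \<and> \<xi> \<in> vfields A UNIV \<and> endo_field A \<phi> \<and>
     (\<forall>p. \<exists>U. open U \<and> p \<in> U \<and>
        (\<exists>X\<in>vfields A U. \<exists>Y\<in>vfields A U. \<exists>Z\<in>vfields A U. wedge_ext_deriv A \<eta> X Y Z p \<noteq> 0)) \<and>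
     (\<forall>p. g p (\<xi> p) (\<xi> p) = 1 \<and> \<eta> p (\<xi> p) = 1) \<and>
     (\<forall>p. \<forall>u\<in>tangent_space A p.
        \<eta> p u = g p u (\<xi> p) \<and> \<phi> p (\<phi> p u) = - u + \<eta> p u \<cdot> \<xi> p) \<and>
     (\<forall>U. open U \<longrightarrow> (\<forall>X\<in>vfields A U. \<forall>p\<in>U. ext_deriv A \<eta> \<xi> X p = 0)) \<and>
     (\<forall>U. open U \<longrightarrow> (\<forall>X\<in>vfields A U. \<forall>Y\<in>vfields A U. \<forall>p\<in>U.
        ext_deriv A \<eta> X Y p = g p (X p) (\<phi> p (Y p))))"

text \<open>Here \<open>(\<nabla>\<^sub>X \<phi>) Y = \<nabla>\<^sub>X (\<phi> Y) - \<phi> (\<nabla>\<^sub>X Y)\<close>.\<close>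

definition sasakian :: "('a::topological_space, 'n::finite) atlas \<Rightarrow> ('a \<Rightarrow> 'a tvec \<Rightarrow> 'a tvec) \<Rightarrow> 'a vfield \<Rightarrow>
    ('a \<Rightarrow> 'a tvec \<Rightarrow> real) \<Rightarrow> ('a \<Rightarrow> 'a tvec \<Rightarrow> 'a tvec \<Rightarrow> real) \<Rightarrow>
    ('a vfield \<Rightarrow> 'a vfield \<Rightarrow> 'a vfield) \<Rightarrow> bool" where
  "sasakian A \<phi> \<xi> \<eta> g D \<longleftrightarrow>
     (\<forall>U. open U \<longrightarrow> (\<forall>X\<in>vfields A U. \<forall>Y\<in>vfields A U. \<forall>p\<in>U.
        D X (\<lambda>q. \<phi> q (Y q)) p - \<phi> p (D X Y p) = g p (X p) (Y p) \<cdot> \<xi> p - \<eta> p (Y p) \<cdot> X p))"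


section \<open>Ricci--Bourguignon solitons\<close>

definition almost_RB_soliton :: "('a::topological_space, 'n::finite) atlas \<Rightarrow>
    ('a \<Rightarrow> 'a tvec \<Rightarrow> 'a tvec \<Rightarrow> real) \<Rightarrow> ('a vfield \<Rightarrow> 'a vfield \<Rightarrow> 'a vfield) \<Rightarrow>
    'a vfield \<Rightarrow> ('a \<Rightarrow> real) \<Rightarrow> real \<Rightarrow> bool" where
  "almost_RB_soliton A g D V l \<rho> \<longleftrightarrow>
     V \<in> vfields A UNIV \<and> l \<in> smooth_funs A UNIV \<and>
     (\<forall>U. open U \<longrightarrow> (\<forall>X\<in>vfields A U. \<forall>Y\<in>vfields A U. \<forall>p\<in>U.
        ricci A g D X Y p + (1/2) * lie_deriv_metric A g V X Y p =
          (l p + \<rho> * scalar_curvature A g D p) * g p (X p) (Y p)))"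

definition RB_soliton :: "('a::topological_space, 'n::finite) atlas \<Rightarrow>
    ('a \<Rightarrow> 'a tvec \<Rightarrow> 'a tvec \<Rightarrow> real) \<Rightarrow> ('a vfield \<Rightarrow> 'a vfield \<Rightarrow> 'a vfield) \<Rightarrow>
    'a vfield \<Rightarrow> ('a \<Rightarrow> real) \<Rightarrow> real \<Rightarrow> bool" where
  "RB_soliton A g D V l \<rho> \<longleftrightarrow> almost_RB_soliton A g D V l \<rho> \<and> (\<exists>c. \<forall>p. l p = c)"

end

theory Submission
  imports Defs
begin

text \<open>
  Since \<open>V\<close> is orthogonal to the geodesic field \<open>\<xi>\<close>, the \<open>(\<xi>, \<xi>)\<close>-component of the soliton
  equation reads \<open>\<lambda> + \<rho> r = Ric(\<xi>, \<xi>) = \<sigma>\<close>. As \<open>\<sigma> = 2 - tr h\<^sup>2\<close> is constant and \<open>M\<close> is not Sasakian,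
  \<open>h\<close> has constant eigenvalues \<open>\<mu>, -\<mu>, 0\<close> with \<open>\<mu> > 0\<close>, and there are local orthonormal frames
  \<open>e\<^sub>1, e\<^sub>2 = \<phi> e\<^sub>1, e\<^sub>3 = \<xi>\<close> of eigenvectors. The equations \<open>Ric(\<xi>, e\<^sub>i) = 0\<close> and the Jacobi identity turn
  such a frame into a unimodular Lie algebra: \<open>[e\<^sub>1, e\<^sub>2] = 2 e\<^sub>3\<close>, \<open>[e\<^sub>2, e\<^sub>3] = (1 - \<mu> + k) e\<^sub>1\<close>,
  \<open>[e\<^sub>3, e\<^sub>1] = (1 + \<mu> + k) e\<^sub>2\<close> with \<open>k\<close> locally constant. The soliton equation prescribes all frame
  derivatives of the two components of \<open>V\<close> up to one function, and their compatibility with the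
  brackets forces \<open>\<mu> = 1\<close> and \<open>k = 0\<close>. Hence \<open>M\<close> is flat whether or not \<open>V\<close> vanishes, and \<open>\<sigma> = 0\<close>.
\<close>

section \<open>Functions of class \<open>C\<^sup>k\<close>\<close>

text \<open>The tensor \<open>h\<close> is never introduced. In a frame with
  \<open>e 2 = \<phi> (e 1)\<close> and \<open>e 3 = \<xi>\<close> its matrix is carried by two
  connection coefficients, g(h e1, e1) = \<open>G 1 2 3 - 1\<close> and g(h e1, e2) =
  \<open>- G 1 1 3\<close>, because \<nabla>_X \<xi> = - \<phi> X - \<phi> h X. The function left
  open by the soliton equation is \<psi> = e1 f2 = - e2 f1, with f1, f2 the components of
  \<open>V\<close>. The bracket [e3, e1] on f1 gives 2 (1 + \<mu>) \<psi> = 0; then the derivatives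
  along e3 vanish too, and algebraic equations in \<mu> and k remain. No step divides by a component
  of \<open>V\<close>. The surviving case \<mu> = 1, k = 0 is the Lie algebra of the Euclidean group
  of the plane with a flat metric. The obstacle lies in the foundations: tangent vectors are
  velocities of curves acting on total functions, and \<open>D\<close> takes total fields as
  arguments. Linear structure, dimension, locality and tensoriality therefore precede every frame
  computation.\<close>

lemma Ck_on_subset: "Ck_on k S f \<Longrightarrow> T \<subseteq> S \<Longrightarrow> Ck_on k T f"
  by (induction k arbitrary: f) (auto intro: continuous_on_subset)

lemma Ck_on_cong:
  assumes "open S" "\<And>x. x \<in> S \<Longrightarrow> f x = g x" "Ck_on k S f"
  shows "Ck_on k S g"
  using assms(2,3)
proof (induction k arbitrary: f g)
  case 0
  then show ?case by (simp cong: continuous_on_cong)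
next
  case (Suc k)
  have d: "g differentiable (at x) \<and> frechet_derivative g (at x) = frechet_derivative f (at x)"
    if "x \<in> S" for x
  proof -
    have f: "f differentiable (at x)" using Suc.prems(2) that by simp
    then have "(g has_derivative frechet_derivative f (at x)) (at x)"
      using has_derivative_transform_within_open[OF _ assms(1) that, of f _ UNIV g] Suc.prems(1)
      by (simp add: frechet_derivative_works)
    then show ?thesis
      using frechet_derivative_transform_within_open[OF f assms(1) that, of g] Suc.prems(1)
      by (auto simp: differentiable_def)
  qed
  have "Ck_on k S (\<lambda>x. frechet_derivative g (at x) v)" for v
    by (rule Suc.IH[of "\<lambda>x. frechet_derivative f (at x) v"]) (use Suc.prems(2) d in auto)
  then show ?case using d by simp
qed

lemma Ck_on_Suc_imp: "Ck_on (Suc k) S f \<Longrightarrow> Ck_on k S f"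
proof (induction k arbitrary: f)
  case 0
  then show ?case
    by (auto intro!: continuous_at_imp_continuous_on differentiable_imp_continuous_within)
qed auto

lemma Ck_on_const: "Ck_on k S (\<lambda>x. c)"
  by (induction k arbitrary: c) auto

lemma Ck_on_add:
  assumes "open S" "Ck_on k S f" "Ck_on k S g"
  shows "Ck_on k S (\<lambda>x. f x + g x)"
  using assms(2,3)
proof (induction k arbitrary: f g)
  case 0
  then show ?case by (simp add: continuous_on_add)
next
  case (Suc k)
  have "Ck_on k S (\<lambda>x. frechet_derivative (\<lambda>x. f x + g x) (at x) v)" for v
  proof (rule Ck_on_cong[OF assms(1)])
    show "Ck_on k S (\<lambda>x. frechet_derivative f (at x) v + frechet_derivative g (at x) v)"
      using Suc by simp
    fix x assume "x \<in> S"
    then have "((\<lambda>x. f x + g x) has_derivative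
        (\<lambda>v. frechet_derivative f (at x) v + frechet_derivative g (at x) v)) (at x)"
      using Suc.prems by (intro has_derivative_add) (auto simp: frechet_derivative_works)
    then show "frechet_derivative f (at x) v + frechet_derivative g (at x) v =
        frechet_derivative (\<lambda>x. f x + g x) (at x) v"
      by (metis frechet_derivative_at)
  qed
  then show ?case using Suc.prems by auto
qed

lemma Ck_on_mult:
  fixes f g :: "'b::real_normed_vector \<Rightarrow> real"
  assumes "open S" "Ck_on k S f" "Ck_on k S g"
  shows "Ck_on k S (\<lambda>x. f x * g x)"
  using assms(2,3)
proof (induction k arbitrary: f g)
  case 0
  then show ?case by (simp add: continuous_on_mult)
next
  case (Suc k)
  have "Ck_on k S (\<lambda>x. frechet_derivative (\<lambda>x. f x * g x) (at x) v)" for v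
  proof (rule Ck_on_cong[OF assms(1)])
    show "Ck_on k S (\<lambda>x. f x * frechet_derivative g (at x) v + frechet_derivative f (at x) v * g x)"
      using Suc.prems Ck_on_Suc_imp[OF Suc.prems(1)] Ck_on_Suc_imp[OF Suc.prems(2)]
      by (intro Ck_on_add assms Suc.IH) auto
    fix x assume "x \<in> S"
    then have "((\<lambda>x. f x * g x) has_derivative
        (\<lambda>v. f x * frechet_derivative g (at x) v + frechet_derivative f (at x) v * g x)) (at x)"
      using Suc.prems by (intro has_derivative_mult) (auto simp: frechet_derivative_works)
    then show "f x * frechet_derivative g (at x) v + frechet_derivative f (at x) v * g x =
        frechet_derivative (\<lambda>x. f x * g x) (at x) v"
      by (metis frechet_derivative_at)
  qed
  then show ?case using Suc.prems by (auto intro: differentiable_mult)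
qed

text \<open>The derivative contains \<open>f x powr (a - 1)\<close>, so the induction runs over all
  exponents at once. The exponent -1/2 later normalizes vector fields.\<close>

lemma Ck_on_powr:
  fixes f :: "'b::real_normed_vector \<Rightarrow> real"
  assumes "open S" "\<And>x. x \<in> S \<Longrightarrow> f x > 0" "Ck_on k S f"
  shows "Ck_on k S (\<lambda>x. f x powr a)"
  using assms(3)
proof (induction k arbitrary: a)
  case 0
  then show ?case using assms(2) by (force intro!: continuous_on_powr)
next
  case (Suc k)
  have D: "((\<lambda>x. f x powr a) has_derivative
        (\<lambda>v. a * f x powr (a - 1) * frechet_derivative f (at x) v)) (at x)" if "x \<in> S" for x
  proof -
    have "(f has_derivative frechet_derivative f (at x)) (at x)"
      using Suc.prems that by (auto simp: frechet_derivative_works)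
    from has_derivative_powr[OF this has_derivative_const[of a] assms(2)[OF that]]
    have "((\<lambda>x. f x powr a) has_derivative (\<lambda>v. f x powr a * (frechet_derivative f (at x) v * a / f x))) (at x)"
      by simp
    moreover have "f x powr a * (w * a / f x) = a * f x powr (a - 1) * w" for w
      using assms(2)[OF that] by (simp add: powr_diff)
    ultimately show ?thesis by simp
  qed
  have "Ck_on k S (\<lambda>x. frechet_derivative (\<lambda>x. f x powr a) (at x) v)" for v
  proof (rule Ck_on_cong[OF assms(1)])
    show "Ck_on k S (\<lambda>x. a * f x powr (a - 1) * frechet_derivative f (at x) v)"
      using Suc.prems Suc.IH Ck_on_Suc_imp[OF Suc.prems]
      by (intro Ck_on_mult assms(1) Ck_on_const) auto
    fix x assume "x \<in> S"
    then show "a * f x powr (a - 1) * frechet_derivative f (at x) v =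
        frechet_derivative (\<lambda>x. f x powr a) (at x) v"
      using D by (metis frechet_derivative_at)
  qed
  then show ?case using D by (auto simp: differentiable_def)
qed

text \<open>The derivative along a line is a directional derivative of \<open>f\<close> on the same
  line, to which the induction hypothesis applies again. This makes coordinate lines smooth in every
  overlapping chart.\<close>

lemma Ck_on_compose_line:
  fixes a v :: "'b::real_normed_vector"
  assumes "open S" "Ck_on k S f"
  shows "Ck_on k {t. a + t *\<^sub>R v \<in> S} (\<lambda>t. f (a + t *\<^sub>R v))"
  using assms(2)
proof (induction k arbitrary: f)
  case 0
  then show ?case
    by (auto intro!: continuous_on_compose2[of S f] continuous_intros)
next
  case (Suc k)
  let ?T = "{t. a + t *\<^sub>R v \<in> S}"
  have oT: "open ?T"
    using open_vimage[OF assms(1), of "\<lambda>t. a + t *\<^sub>R v"] by (simp add: vimage_def continuous_intros)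
  have D: "((\<lambda>t. f (a + t *\<^sub>R v)) has_derivative
        (\<lambda>s. s *\<^sub>R frechet_derivative f (at (a + t *\<^sub>R v)) v)) (at t)" if "t \<in> ?T" for t
  proof -
    have f: "(f has_derivative frechet_derivative f (at (a + t *\<^sub>R v))) (at (a + t *\<^sub>R v))"
      using Suc.prems that by (auto simp: frechet_derivative_works)
    have "((\<lambda>t. a + t *\<^sub>R v) has_derivative (\<lambda>s. s *\<^sub>R v)) (at t)"
      by (auto intro!: derivative_eq_intros)
    from has_derivative_compose[OF this f]
    show ?thesis
      by (simp add: linear_scale[OF has_derivative_linear[OF f]])
  qed
  have "Ck_on k ?T (\<lambda>t. frechet_derivative (\<lambda>t. f (a + t *\<^sub>R v)) (at t) w)" for w
  proof (rule Ck_on_cong[OF oT])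
    have "Ck_on k S (\<lambda>x. frechet_derivative f (at x) (w *\<^sub>R v))" using Suc.prems by simp
    then show "Ck_on k ?T (\<lambda>t. frechet_derivative f (at (a + t *\<^sub>R v)) (w *\<^sub>R v))"
      by (rule Suc.IH)
    fix t assume t: "t \<in> ?T"
    then have "f differentiable (at (a + t *\<^sub>R v))" using Suc.prems by auto
    then show "frechet_derivative f (at (a + t *\<^sub>R v)) (w *\<^sub>R v) =
        frechet_derivative (\<lambda>t. f (a + t *\<^sub>R v)) (at t) w"
      using frechet_derivative_at[OF D[OF t], symmetric]
      by (simp add: linear_scale[OF linear_frechet_derivative])
  qed
  then show ?case using D by (auto simp: differentiable_def)
qed

section \<open>Smooth functions and tangent vectors\<close>

lemma tscale_apply [simp]: "(c \<cdot> v) f = c * v f"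
  by (simp add: tscale_def)

lemma tscale_right_diff_distrib: "c \<cdot> (u - v) = c \<cdot> u - c \<cdot> v"
  and tscale_left_diff_distrib: "(c - d) \<cdot> v = c \<cdot> v - d \<cdot> v"
  and tscale_tscale [simp]: "c \<cdot> d \<cdot> v = (c * d) \<cdot> v"
  and tscale_one [simp]: "1 \<cdot> v = v"
  and tscale_zero_right [simp]: "c \<cdot> 0 = 0"
  and tscale_zero_left [simp]: "0 \<cdot> v = 0"
  and tscale_minus_left [simp]: "(- c) \<cdot> v = - (c \<cdot> v)"
  and tscale_minus_right [simp]: "c \<cdot> (- v) = - (c \<cdot> v)"
  by (simp_all add: fun_eq_iff algebra_simps)

lemma tvec_sum_apply: "(\<Sum>i\<in>I. v i) f = (\<Sum>i\<in>I. (v i :: 'a tvec) f)"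
  by (induction I rule: infinite_finite_induct) auto

text \<open>The tangent vector with components \<open>w\<close> in the chart \<open>x\<close>. The
  default 0 copies the convention of \<open>velocity\<close>, so that the two agree as total
  functions.\<close>

definition coord_vec :: "('a::topological_space, 'n::finite) atlas \<Rightarrow> 'a set \<Rightarrow> ('a \<Rightarrow> real ^ 'n) \<Rightarrow> 'a \<Rightarrow> real ^ 'n \<Rightarrow> 'a tvec" where
  "coord_vec A W x p w =
     (\<lambda>f. if smooth_near A p f then frechet_derivative (f \<circ> inv_into W x) (at (x p)) w else 0)"

locale smooth_manifold =
  fixes A :: "('a::t2_space, 'n::finite) atlas"
  assumes atlas: "smooth_atlas A"
begin

abbreviation "SF \<equiv> smooth_funs A"
abbreviation "VF \<equiv> vfields A"
abbreviation "T \<equiv> tangent_space A"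
abbreviation "near \<equiv> smooth_near A"

section \<open>Charts and the ring of smooth functions\<close>

lemma chart_at:
  obtains W x where "(W, x) \<in> A" "p \<in> W"
proof -
  have "p \<in> (\<Union>(W, x)\<in>A. W)" using atlas unfolding smooth_atlas_def by simp
  then show ?thesis using that by auto
qed

lemma
  assumes "(W, x) \<in> A"
  shows chart_open: "open W"
    and chart_homeomorphism: "homeomorphism W (x ` W) x (inv_into W x)"
    and chart_image_open': "open (x ` W)"
  using atlas assms unfolding smooth_atlas_def by auto

lemma chart_inv: "(W, x) \<in> A \<Longrightarrow> q \<in> W \<Longrightarrow> inv_into W x (x q) = q"
  using chart_homeomorphism homeomorphism_apply1 by blast

lemma chart_image_open:
  assumes "(W, x) \<in> A" "open U"
  shows "open (x ` (U \<inter> W))"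
proof -
  have "openin (top_of_set (x ` W)) (x ` (U \<inter> W))"
    using assms by (intro homeomorphism_imp_open_map[OF chart_homeomorphism]) (auto simp: openin_open)
  then show ?thesis
    using openin_open_trans chart_image_open' assms(1) by blast
qed

lemma chart_transition:
  "(W, x) \<in> A \<Longrightarrow> (W', x') \<in> A \<Longrightarrow> smooth_on (x ` (W \<inter> W')) (x' \<circ> inv_into W x)"
  using atlas unfolding smooth_atlas_def by fast

lemma sf_Ck: "f \<in> SF U \<Longrightarrow> (W, x) \<in> A \<Longrightarrow> Ck_on k (x ` (U \<inter> W)) (f \<circ> inv_into W x)"
  unfolding smooth_funs_def smooth_on_def by auto

lemma sfI:
  assumes "\<And>k W x. (W, x) \<in> A \<Longrightarrow> Ck_on k (x ` (U \<inter> W)) (f \<circ> inv_into W x)"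
  shows "f \<in> SF U"
  using assms unfolding smooth_funs_def smooth_on_def by auto

lemma sf_subset: "f \<in> SF U \<Longrightarrow> U' \<subseteq> U \<Longrightarrow> f \<in> SF U'"
  by (rule sfI, rule Ck_on_subset[OF sf_Ck]) auto

lemma sf_cong:
  assumes "open U" "f \<in> SF U" "\<And>q. q \<in> U \<Longrightarrow> f q = g q"
  shows "g \<in> SF U"
proof (rule sfI)
  fix k W x assume W: "(W, x) \<in> A"
  show "Ck_on k (x ` (U \<inter> W)) (g \<circ> inv_into W x)"
    by (rule Ck_on_cong[OF chart_image_open[OF W assms(1)] _ sf_Ck[OF assms(2) W]])
       (use assms(3) in \<open>auto simp: chart_inv[OF W]\<close>)
qed

lemma sf_const: "(\<lambda>q. c) \<in> SF U"
  by (rule sfI) (simp add: o_def Ck_on_const)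

lemma sf_add: "open U \<Longrightarrow> f \<in> SF U \<Longrightarrow> g \<in> SF U \<Longrightarrow> (\<lambda>q. f q + g q) \<in> SF U"
  by (rule sfI) (use Ck_on_add[OF chart_image_open sf_Ck sf_Ck] in \<open>simp add: o_def\<close>)

lemma sf_mult: "open U \<Longrightarrow> f \<in> SF U \<Longrightarrow> g \<in> SF U \<Longrightarrow> (\<lambda>q. f q * g q) \<in> SF U"
  by (rule sfI) (use Ck_on_mult[OF chart_image_open sf_Ck sf_Ck] in \<open>simp add: o_def\<close>)

lemma sf_uminus: "open U \<Longrightarrow> f \<in> SF U \<Longrightarrow> (\<lambda>q. - f q) \<in> SF U"
  using sf_mult[OF _ sf_const[of "-1"]] by simp

lemma sf_diff: "open U \<Longrightarrow> f \<in> SF U \<Longrightarrow> g \<in> SF U \<Longrightarrow> (\<lambda>q. f q - g q) \<in> SF U"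
  using sf_add[OF _ _ sf_uminus] by simp

lemma sf_powr:
  assumes "open U" "f \<in> SF U" "\<And>q. q \<in> U \<Longrightarrow> f q > 0"
  shows "(\<lambda>q. f q powr a) \<in> SF U"
proof (rule sfI)
  fix k W x assume W: "(W, x) \<in> A"
  show "Ck_on k (x ` (U \<inter> W)) ((\<lambda>q. f q powr a) \<circ> inv_into W x)"
    unfolding o_def
    by (rule Ck_on_powr[OF chart_image_open[OF W assms(1)] _ sf_Ck[OF assms(2) W, unfolded o_def]])
       (use assms(3) in \<open>auto simp: chart_inv[OF W]\<close>)
qed

lemma sf_continuous:
  assumes "open U" "f \<in> SF U"
  shows "continuous_on U f"
proof -
  have "isCont f p" if p: "p \<in> U" for p
  proof -
    obtain W x where W: "(W, x) \<in> A" "p \<in> W" by (rule chart_at)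
    have "continuous_on (x ` (U \<inter> W)) (f \<circ> inv_into W x)"
      using sf_Ck[OF assms(2) W(1), of 0] by simp
    moreover have "continuous_on (U \<inter> W) x"
      using chart_homeomorphism[OF W(1)] by (auto simp: homeomorphism_def intro: continuous_on_subset)
    ultimately have "continuous_on (U \<inter> W) (\<lambda>q. (f \<circ> inv_into W x) (x q))"
      by (rule continuous_on_compose2) auto
    then have "continuous_on (U \<inter> W) f"
      by (rule continuous_on_eq) (simp add: chart_inv[OF W(1)])
    then show ?thesis
      using p W chart_open[OF W(1)] assms(1) by (auto simp: continuous_on_eq_continuous_at open_Int)
  qed
  then show ?thesis by (auto intro: continuous_at_imp_continuous_on)
qed

lemma sf_open_pos:
  assumes "open U" "f \<in> SF U"
  shows "open {q \<in> U. f q > 0}"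
  using continuous_on_open_vimage[OF assms(1), THEN iffD1, OF sf_continuous[OF assms], rule_format, of "{0<..}"]
  by (simp add: vimage_def Int_def conj_commute)

lemma nearI: "open U \<Longrightarrow> p \<in> U \<Longrightarrow> f \<in> SF U \<Longrightarrow> near p f"
  unfolding smooth_near_def by auto

lemma near_obtain2:
  assumes "near p f" "near p g"
  obtains U where "open U" "p \<in> U" "f \<in> SF U" "g \<in> SF U"
proof -
  obtain U V where "open U" "p \<in> U" "f \<in> SF U" "open V" "p \<in> V" "g \<in> SF V"
    using assms unfolding smooth_near_def by auto
  then show ?thesis by (intro that[of "U \<inter> V"]) (auto intro: sf_subset)
qed

lemma near_add: "near p f \<Longrightarrow> near p g \<Longrightarrow> near p (\<lambda>q. f q + g q)"
  by (erule (1) near_obtain2) (blast intro: nearI sf_add)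

lemma near_mult: "near p f \<Longrightarrow> near p g \<Longrightarrow> near p (\<lambda>q. f q * g q)"
  by (erule (1) near_obtain2) (blast intro: nearI sf_mult)

lemma near_const: "near p (\<lambda>q. c)"
  by (rule nearI[of UNIV]) (auto intro: sf_const)

section \<open>Tangent vectors in coordinates\<close>

lemma near_differentiable:
  assumes "near p f" "(W, x) \<in> A" "p \<in> W"
  shows "(f \<circ> inv_into W x) differentiable (at (x p))"
proof -
  obtain U where "open U" "p \<in> U" "f \<in> SF U" using assms(1) unfolding smooth_near_def by auto
  then show ?thesis using sf_Ck[OF _ assms(2), of f U "Suc 0"] assms(3) by auto
qed

lemma velocity_deriv:
  assumes c: "smooth_curve A J \<gamma>" and t: "t \<in> J" and W: "(W, x) \<in> A" "\<gamma> t \<in> W" and f: "near (\<gamma> t) f"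
  shows "((\<lambda>s. f (\<gamma> s)) has_real_derivative
     frechet_derivative (f \<circ> inv_into W x) (at (x (\<gamma> t))) (vector_derivative (x \<circ> \<gamma>) (at t))) (at t)"
proof -
  have J: "open J" "continuous_on J \<gamma>" and "smooth_on {s \<in> J. \<gamma> s \<in> W} (x \<circ> \<gamma>)"
    using c W(1) unfolding smooth_curve_def by auto
  then have "Ck_on (Suc 0) {s \<in> J. \<gamma> s \<in> W} (x \<circ> \<gamma>)" unfolding smooth_on_def by blast
  then have "(x \<circ> \<gamma>) differentiable (at t)" using t W(2) by simp
  then have 1: "((x \<circ> \<gamma>) has_vector_derivative vector_derivative (x \<circ> \<gamma>) (at t)) (at t)"
    by (simp add: vector_derivative_works)
  have 2: "((f \<circ> inv_into W x) has_derivative frechet_derivative (f \<circ> inv_into W x) (at (x (\<gamma> t)))) (at ((x \<circ> \<gamma>) t))"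
    using near_differentiable[OF f W] by (simp add: frechet_derivative_works)
  have "((\<lambda>s. (f \<circ> inv_into W x) ((x \<circ> \<gamma>) s)) has_derivative
     (\<lambda>s. frechet_derivative (f \<circ> inv_into W x) (at (x (\<gamma> t))) (s *\<^sub>R vector_derivative (x \<circ> \<gamma>) (at t)))) (at t)"
    using has_derivative_compose[OF 1[unfolded has_vector_derivative_def] 2] .
  moreover have "(\<lambda>s. frechet_derivative (f \<circ> inv_into W x) (at (x (\<gamma> t))) (s *\<^sub>R vector_derivative (x \<circ> \<gamma>) (at t))) =
      (*) (frechet_derivative (f \<circ> inv_into W x) (at (x (\<gamma> t))) (vector_derivative (x \<circ> \<gamma>) (at t)))"
    by (simp add: fun_eq_iff linear_scale[OF has_derivative_linear[OF 2]])
  ultimately have 3: "((\<lambda>s. (f \<circ> inv_into W x) ((x \<circ> \<gamma>) s)) has_real_derivative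
     frechet_derivative (f \<circ> inv_into W x) (at (x (\<gamma> t))) (vector_derivative (x \<circ> \<gamma>) (at t))) (at t)"
    by (simp add: has_field_derivative_def)
  have "open {s \<in> J. \<gamma> s \<in> W}"
    using continuous_on_open_vimage[OF J(1), THEN iffD1, OF J(2), rule_format, OF chart_open[OF W(1)]]
    by (simp add: vimage_def Int_def conj_commute)
  show ?thesis
    by (rule has_field_derivative_transform_within_open[OF 3 \<open>open {s \<in> J. \<gamma> s \<in> W}\<close>]) (use t W in \<open>auto simp: chart_inv\<close>)
qed

lemma velocity_eq_coord_vec:
  assumes "smooth_curve A J \<gamma>" "t \<in> J" "(W, x) \<in> A" "\<gamma> t \<in> W"
  shows "velocity A \<gamma> t = coord_vec A W x (\<gamma> t) (vector_derivative (x \<circ> \<gamma>) (at t))"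
  unfolding velocity_def coord_vec_def using velocity_deriv[OF assms] DERIV_imp_deriv by (auto simp: fun_eq_iff)

lemma coord_vec_in_tangent:
  assumes W: "(W, x) \<in> A" "p \<in> W"
  shows "coord_vec A W x p w \<in> T p"
proof -
  let ?S = "{t. x p + t *\<^sub>R w \<in> x ` W}"
  \<comment> \<open>The straight coordinate line through \<open>x p\<close> in direction
    \<open>w\<close>; its velocity at 0 is the wanted vector.\<close>
  define \<gamma> where "\<gamma> = (\<lambda>t. inv_into W x (x p + t *\<^sub>R w))"
  have oS: "open ?S"
    using open_vimage[OF chart_image_open'[OF W(1)], of "\<lambda>t. x p + t *\<^sub>R w"]
    by (simp add: vimage_def continuous_intros)
  have "0 \<in> ?S" using W by simp
  then obtain \<epsilon> where \<epsilon>: "\<epsilon> > 0" "ball 0 \<epsilon> \<subseteq> ?S" using oS openE by blast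
  have J: "{-\<epsilon><..<\<epsilon>} \<subseteq> ?S" using \<epsilon>(2) by (auto simp: ball_def dist_real_def subset_iff)
  have inS: "\<gamma> t \<in> W" "x (\<gamma> t) = x p + t *\<^sub>R w" if "t \<in> ?S" for t
    using that by (auto simp: \<gamma>_def inv_into_into f_inv_into_f)
  have c: "smooth_curve A {-\<epsilon><..<\<epsilon>} \<gamma>"
    unfolding smooth_curve_def
  proof (intro conjI ballI)
    show "continuous_on {-\<epsilon><..<\<epsilon>} \<gamma>" unfolding \<gamma>_def
      using chart_homeomorphism[OF W(1)] J unfolding homeomorphism_def
      by (auto intro!: continuous_on_compose2[of "x ` W" "inv_into W x"] continuous_intros)
    fix c assume "c \<in> A"
    then obtain W' x' where [simp]: "c = (W', x')" and W': "(W', x') \<in> A" by (cases c) auto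
    have "Ck_on k {t \<in> {-\<epsilon><..<\<epsilon>}. \<gamma> t \<in> W'} (x' \<circ> \<gamma>)" for k
    proof -
      have "Ck_on k {t. x p + t *\<^sub>R w \<in> x ` (W \<inter> W')} (\<lambda>t. (x' \<circ> inv_into W x) (x p + t *\<^sub>R w))"
        using chart_transition[OF W(1) W', unfolded smooth_on_def] chart_image_open[OF W(1) chart_open[OF W']]
        by (intro Ck_on_compose_line) (simp_all add: Int_commute del: o_apply)
      then show ?thesis
        unfolding \<gamma>_def o_def
      proof (rule Ck_on_subset, intro subsetI)
        fix t assume t: "t \<in> {t \<in> {-\<epsilon><..<\<epsilon>}. inv_into W x (x p + t *\<^sub>R w) \<in> W'}"
        then have "t \<in> ?S" using J by blast
        with inS[OF this] t show "t \<in> {t. x p + t *\<^sub>R w \<in> x ` (W \<inter> W')}" unfolding \<gamma>_def by (metis (no_types, lifting) IntI image_eqI mem_Collect_eq)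
      qed
    qed
    then show "case c of (W, x) \<Rightarrow> smooth_on {t \<in> {-\<epsilon><..<\<epsilon>}. \<gamma> t \<in> W} (x \<circ> \<gamma>)"
      by (simp add: smooth_on_def)
  qed auto
  have \<gamma>0: "\<gamma> 0 = p" by (simp add: \<gamma>_def chart_inv[OF W])
  have "((\<lambda>t. x p + t *\<^sub>R w) has_vector_derivative w) (at 0)"
    by (auto intro!: derivative_eq_intros simp: has_vector_derivative_def)
  then have "((x \<circ> \<gamma>) has_vector_derivative w) (at 0)"
    by (rule has_vector_derivative_transform_within_open[OF _ oS]) (use \<open>0 \<in> ?S\<close> inS in auto)
  then have "velocity A \<gamma> 0 = coord_vec A W x p w"
    using velocity_eq_coord_vec[OF c _ W(1), of 0] \<gamma>0 W(2) \<epsilon>(1) by (simp add: vector_derivative_at)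
  then show ?thesis unfolding tangent_space_def using c \<epsilon>(1) \<gamma>0
    by (intro CollectI exI[of _ \<gamma>] exI[of _ \<epsilon>]) simp
qed

text \<open>Velocities of curves are not visibly closed under addition. Identifying them with the
  coordinate vectors of one chart gives \<open>T p\<close> its vector space structure.\<close>

lemma tangent_space_chart:
  assumes W: "(W, x) \<in> A" "p \<in> W"
  shows "T p = range (coord_vec A W x p)"
proof -
  have "v \<in> range (coord_vec A W x p)" if v: "v \<in> T p" for v
  proof -
    obtain \<gamma> \<epsilon> where "\<epsilon> > 0" "smooth_curve A {-\<epsilon><..<\<epsilon>} \<gamma>" "\<gamma> 0 = p" "v = velocity A \<gamma> 0"
      using v unfolding tangent_space_def by auto
    then show ?thesis using velocity_eq_coord_vec[of _ \<gamma> 0 W x] W by auto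
  qed
  then show ?thesis using coord_vec_in_tangent[OF W] by auto
qed

lemma coord_vec_add:
  assumes "(W, x) \<in> A" "p \<in> W"
  shows "coord_vec A W x p (v + w) = coord_vec A W x p v + coord_vec A W x p w"
  using linear_add[OF linear_frechet_derivative[OF near_differentiable[OF _ assms]]]
  by (auto simp: coord_vec_def fun_eq_iff)

lemma coord_vec_scale:
  assumes "(W, x) \<in> A" "p \<in> W"
  shows "coord_vec A W x p (c *\<^sub>R v) = c \<cdot> coord_vec A W x p v"
  using linear_scale[OF linear_frechet_derivative[OF near_differentiable[OF _ assms]]]
  by (auto simp: coord_vec_def fun_eq_iff)

lemma coord_vec_sum:
  assumes "(W, x) \<in> A" "p \<in> W"
  shows "coord_vec A W x p (\<Sum>i\<in>I. v i) = (\<Sum>i\<in>I. coord_vec A W x p (v i))"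
  using coord_vec_scale[OF assms, of 0]
  by (induction I rule: infinite_finite_induct) (auto simp: coord_vec_add[OF assms])

lemma tangent_add [simp, intro]: "u \<in> T p \<Longrightarrow> v \<in> T p \<Longrightarrow> u + v \<in> T p"
  by (rule chart_at[of p]) (auto simp: tangent_space_chart coord_vec_add[symmetric])

lemma tangent_scale [simp, intro]: "v \<in> T p \<Longrightarrow> c \<cdot> v \<in> T p"
  by (rule chart_at[of p]) (auto simp: tangent_space_chart coord_vec_scale[symmetric])

lemma tangent_zero [simp, intro]: "0 \<in> T p"
proof (rule chart_at[of p])
  fix W x assume "(W, x) \<in> A" "p \<in> W"
  then have "0 \<cdot> coord_vec A W x p 0 \<in> T p" using coord_vec_in_tangent by blast
  then show ?thesis by simp
qed

lemma tangent_uminus [simp, intro]: "v \<in> T p \<Longrightarrow> - v \<in> T p"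
  using tangent_scale[of v p "-1"] by simp

lemma tangent_diff [simp, intro]: "u \<in> T p \<Longrightarrow> v \<in> T p \<Longrightarrow> u - v \<in> T p"
  using tangent_add[of u p "- v"] by simp

lemma tangent_sum [simp, intro]: "(\<And>i. i \<in> I \<Longrightarrow> v i \<in> T p) \<Longrightarrow> (\<Sum>i\<in>I. v i) \<in> T p"
  by (induction I rule: infinite_finite_induct) auto

lemma tangent_obtain:
  assumes "v \<in> T p"
  obtains W x w where "(W, x) \<in> A" "p \<in> W" "v = coord_vec A W x p w"
  using assms chart_at[of p] tangent_space_chart by (metis imageE)

section \<open>Tangent vectors as derivations\<close>

lemma tangent_fun_add:
  assumes "v \<in> T p" "near p f" "near p g"
  shows "v (\<lambda>q. f q + g q) = v f + v g"
proof -
  obtain W x w where W: "(W, x) \<in> A" "p \<in> W" and v: "v = coord_vec A W x p w"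
    by (rule tangent_obtain[OF assms(1)])
  have "frechet_derivative (\<lambda>y. (f \<circ> inv_into W x) y + (g \<circ> inv_into W x) y) (at (x p)) =
      (\<lambda>w. frechet_derivative (f \<circ> inv_into W x) (at (x p)) w + frechet_derivative (g \<circ> inv_into W x) (at (x p)) w)"
    using near_differentiable[OF assms(2) W] near_differentiable[OF assms(3) W]
    by (intro frechet_derivative_at[symmetric] has_derivative_add) (simp_all only: frechet_derivative_works)
  then show ?thesis using assms near_add unfolding v coord_vec_def by (simp add: o_def)
qed

lemma tangent_fun_mult:
  assumes "v \<in> T p" "near p f" "near p g"
  shows "v (\<lambda>q. f q * g q) = f p * v g + v f * g p"
proof -
  obtain W x w where W: "(W, x) \<in> A" "p \<in> W" and v: "v = coord_vec A W x p w"
    by (rule tangent_obtain[OF assms(1)])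
  have "frechet_derivative (\<lambda>y. (f \<circ> inv_into W x) y * (g \<circ> inv_into W x) y) (at (x p)) =
      (\<lambda>w. (f \<circ> inv_into W x) (x p) * frechet_derivative (g \<circ> inv_into W x) (at (x p)) w
         + frechet_derivative (f \<circ> inv_into W x) (at (x p)) w * (g \<circ> inv_into W x) (x p))"
    using near_differentiable[OF assms(2) W] near_differentiable[OF assms(3) W]
    by (intro frechet_derivative_at[symmetric] has_derivative_mult) (simp_all only: frechet_derivative_works)
  then show ?thesis using assms near_mult unfolding v coord_vec_def by (simp add: o_def chart_inv[OF W])
qed

lemma tangent_fun_const: "v \<in> T p \<Longrightarrow> v (\<lambda>q. c) = 0"
  by (erule tangent_obtain) (simp add: coord_vec_def o_def)

lemma tangent_fun_not_near: "v \<in> T p \<Longrightarrow> \<not> near p f \<Longrightarrow> v f = 0"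
  by (erule tangent_obtain) (simp add: coord_vec_def)

text \<open>Only the germ matters: the derivative in a chart is local, and the smoothness test in
  \<open>coord_vec\<close> has the same outcome for both functions.\<close>

lemma tangent_fun_cong:
  assumes "v \<in> T p" "open U" "p \<in> U" "f \<in> SF U" "\<And>q. q \<in> U \<Longrightarrow> f q = g q"
  shows "v f = v g"
proof -
  have g: "g \<in> SF U" using sf_cong assms by blast
  have fg: "near p f" "near p g" using nearI assms g by blast+
  obtain W x w where W: "(W, x) \<in> A" "p \<in> W" and v: "v = coord_vec A W x p w"
    by (rule tangent_obtain[OF assms(1)])
  have "frechet_derivative (f \<circ> inv_into W x) (at (x p)) = frechet_derivative (g \<circ> inv_into W x) (at (x p))"
    by (rule frechet_derivative_transform_within_open[OF near_differentiable[OF fg(1) W] chart_image_open[OF W(1) assms(2)]])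
       (use assms W in \<open>auto simp: chart_inv\<close>)
  then show ?thesis unfolding v coord_vec_def using fg by simp
qed

lemma tangent_fun_cmult: "v \<in> T p \<Longrightarrow> near p f \<Longrightarrow> v (\<lambda>q. c * f q) = c * v f"
  using tangent_fun_mult[OF _ near_const, of v p f c] tangent_fun_const[of v p c] by simp

lemma tangent_fun_uminus: "v \<in> T p \<Longrightarrow> near p f \<Longrightarrow> v (\<lambda>q. - f q) = - v f"
  using tangent_fun_cmult[of v p f "-1"] by simp

lemma near_uminus: "near p f \<Longrightarrow> near p (\<lambda>q. - f q)"
  using near_mult[OF near_const[of p "-1"]] by simp

lemma tangent_fun_diff:
  "v \<in> T p \<Longrightarrow> near p f \<Longrightarrow> near p g \<Longrightarrow> v (\<lambda>q. f q - g q) = v f - v g"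
  using tangent_fun_add[OF _ _ near_uminus, of v p f g] tangent_fun_uminus[of v p g] by simp

lemma near_sum: "(\<And>i. i \<in> I \<Longrightarrow> near p (f i)) \<Longrightarrow> near p (\<lambda>q. \<Sum>i\<in>I. f i q)"
  by (induction I rule: infinite_finite_induct) (auto simp: near_const intro: near_add)

lemma tangent_fun_sum:
  "v \<in> T p \<Longrightarrow> (\<And>i. i \<in> I \<Longrightarrow> near p (f i)) \<Longrightarrow> v (\<lambda>q. \<Sum>i\<in>I. f i q) = (\<Sum>i\<in>I. v (f i))"
proof (induction I rule: infinite_finite_induct)
  case (insert i I)
  then show ?case using tangent_fun_add[of v p "f i" "\<lambda>q. \<Sum>j\<in>I. f j q"] by (simp add: near_sum)
qed (simp_all add: tangent_fun_const)

text \<open>The linear map from coefficients to the coordinates of the combination goes to a space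
  of smaller dimension and is not injective. This dimension bound later makes orthonormal frames
  span.\<close>

lemma tangent_dependent:
  fixes u :: "'m::finite \<Rightarrow> 'a tvec"
  assumes u: "\<And>i. u i \<in> T p" and card: "CARD('n) < CARD('m)"
  obtains c where "c \<noteq> (\<lambda>i. 0)" "(\<Sum>i\<in>UNIV. c i \<cdot> u i) = 0"
proof -
  obtain W x where W: "(W, x) \<in> A" "p \<in> W" by (rule chart_at)
  then have "\<forall>i. \<exists>b. u i = coord_vec A W x p b" using u tangent_space_chart by blast
  then obtain b where b: "\<And>i. u i = coord_vec A W x p (b i)" by metis
  define F :: "real ^ 'm \<Rightarrow> real ^ 'n" where "F = (\<lambda>c. \<Sum>i\<in>UNIV. c $ i *\<^sub>R b i)"
  have F: "linear F"
    unfolding F_def by (rule linearI) (auto simp: scaleR_left_distrib sum.distrib scaleR_sum_right)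
  have "\<not> inj F"
  proof
    assume "inj F"
    then have "dim (range F) = DIM(real ^ 'm)" using dim_image_eq[OF F, of UNIV] by simp
    then show False using dim_subset_UNIV[of "range F"] card by simp
  qed
  then obtain c where c: "c \<noteq> 0" "F c = 0" using linear_injective_0[OF F] by auto
  have "(\<Sum>i\<in>UNIV. c $ i \<cdot> u i) = coord_vec A W x p (F c)"
    by (simp add: b F_def coord_vec_sum[OF W] coord_vec_scale[OF W])
  also have "\<dots> = 0" using coord_vec_scale[OF W, of 0 0] c(2) by simp
  finally show ?thesis using c(1) by (intro that[of "($) c"]) (auto simp: fun_eq_iff vec_eq_iff)
qed

section \<open>Operations on vector fields\<close>

lemma vf_tangent [intro]: "X \<in> VF U \<Longrightarrow> p \<in> U \<Longrightarrow> X p \<in> T p"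
  by (simp add: vfields_def)

lemma vf_apply: "X \<in> VF U \<Longrightarrow> open U \<Longrightarrow> f \<in> SF U \<Longrightarrow> (\<lambda>p. X p f) \<in> SF U"
  unfolding vfields_def by auto

lemma vf_subset: "X \<in> VF U \<Longrightarrow> U' \<subseteq> U \<Longrightarrow> X \<in> VF U'"
  unfolding vfields_def by (auto intro: subset_trans)

lemma vfI:
  assumes "\<And>p. p \<in> U \<Longrightarrow> X p \<in> T p"
    "\<And>W f. open W \<Longrightarrow> W \<subseteq> U \<Longrightarrow> f \<in> SF W \<Longrightarrow> (\<lambda>p. X p f) \<in> SF W"
  shows "X \<in> VF U"
  using assms unfolding vfields_def by auto

lemma vf_apply_subset: "X \<in> VF U \<Longrightarrow> open W \<Longrightarrow> W \<subseteq> U \<Longrightarrow> f \<in> SF W \<Longrightarrow> (\<lambda>p. X p f) \<in> SF W"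
  unfolding vfields_def by auto

lemma vf_cong:
  assumes "X \<in> VF U" "\<And>q. q \<in> U \<Longrightarrow> X q = Y q"
  shows "Y \<in> VF U"
proof (rule vfI)
  show "Y p \<in> T p" if "p \<in> U" for p using assms that by (metis vf_tangent)
  show "(\<lambda>p. Y p f) \<in> SF W" if "open W" "W \<subseteq> U" "f \<in> SF W" for W f
    by (rule sf_cong[OF that(1) vf_apply_subset[OF assms(1) that]]) (use assms(2) that in auto)
qed

lemma vf_zero: "(\<lambda>q. 0) \<in> VF U"
  by (rule vfI) (auto simp: sf_const)

lemma vf_add: "X \<in> VF U \<Longrightarrow> Y \<in> VF U \<Longrightarrow> (\<lambda>q. X q + Y q) \<in> VF U"
  by (rule vfI) (auto intro: sf_add vf_apply_subset)

lemma vf_scale: "X \<in> VF U \<Longrightarrow> f \<in> SF U \<Longrightarrow> (\<lambda>q. f q \<cdot> X q) \<in> VF U"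
  by (rule vfI) (auto intro: sf_mult vf_apply_subset sf_subset)

lemma vf_uminus: "X \<in> VF U \<Longrightarrow> (\<lambda>q. - X q) \<in> VF U"
  using vf_scale[OF _ sf_const[of "-1"]] by simp

lemma vf_diff: "X \<in> VF U \<Longrightarrow> Y \<in> VF U \<Longrightarrow> (\<lambda>q. X q - Y q) \<in> VF U"
  using vf_add[OF _ vf_uminus] by simp

lemma vf_sum: "(\<And>i. i \<in> I \<Longrightarrow> X i \<in> VF U) \<Longrightarrow> (\<lambda>q. \<Sum>i\<in>I. X i q) \<in> VF U"
  by (induction I rule: infinite_finite_induct) (auto simp: vf_zero intro: vf_add)

end

section \<open>The Levi-Civita connection and its curvature\<close>

locale riemannian_manifold = smooth_manifold A
  for A :: "('a::t2_space, 'n::finite) atlas" +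
  fixes g :: "'a \<Rightarrow> 'a tvec \<Rightarrow> 'a tvec \<Rightarrow> real"
    and D :: "'a vfield \<Rightarrow> 'a vfield \<Rightarrow> 'a vfield"
  assumes metric: "riemannian_metric A g"
    and lc: "levi_civita A g D"
begin

abbreviation "Br \<equiv> lie_bracket A"
abbreviation "R \<equiv> curvature A D"
abbreviation "Ric \<equiv> ricci A g D"

lemma
  assumes "u \<in> T p" "v \<in> T p"
  shows g_sym: "g p u v = g p v u"
    and g_scale_left [simp]: "g p (c \<cdot> u) v = c * g p u v"
  using metric assms unfolding riemannian_metric_def by blast+

lemma g_add_left [simp]:
  "u \<in> T p \<Longrightarrow> v \<in> T p \<Longrightarrow> w \<in> T p \<Longrightarrow> g p (u + v) w = g p u w + g p v w"
  using metric unfolding riemannian_metric_def by blast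

lemma g_pos: "u \<in> T p \<Longrightarrow> u \<noteq> 0 \<Longrightarrow> g p u u > 0"
  using metric unfolding riemannian_metric_def by auto

lemma g_add_right [simp]:
  "u \<in> T p \<Longrightarrow> v \<in> T p \<Longrightarrow> w \<in> T p \<Longrightarrow> g p w (u + v) = g p w u + g p w v"
  using g_add_left[of u p v w] g_sym[of w p] by simp

lemma g_scale_right [simp]: "u \<in> T p \<Longrightarrow> v \<in> T p \<Longrightarrow> g p u (c \<cdot> v) = c * g p u v"
  using g_scale_left[of v p u c] g_sym[of u p] by simp

lemma g_zero_left [simp]: "u \<in> T p \<Longrightarrow> g p 0 u = 0"
  using g_scale_left[of 0 p u 0] by simp

lemma g_zero_right [simp]: "u \<in> T p \<Longrightarrow> g p u 0 = 0"
  using g_scale_right[of u p 0 0] by simp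

lemma g_minus_left [simp]: "u \<in> T p \<Longrightarrow> v \<in> T p \<Longrightarrow> g p (- u) v = - g p u v"
  using g_scale_left[of u p v "-1"] by simp

lemma g_minus_right [simp]: "u \<in> T p \<Longrightarrow> v \<in> T p \<Longrightarrow> g p u (- v) = - g p u v"
  using g_scale_right[of u p v "-1"] by simp

lemma g_diff_left [simp]:
  "u \<in> T p \<Longrightarrow> v \<in> T p \<Longrightarrow> w \<in> T p \<Longrightarrow> g p (u - v) w = g p u w - g p v w"
  using g_add_left[of u p "- v" w] by simp

lemma g_diff_right [simp]:
  "u \<in> T p \<Longrightarrow> v \<in> T p \<Longrightarrow> w \<in> T p \<Longrightarrow> g p w (u - v) = g p w u - g p w v"
  using g_add_right[of u p "- v" w] by simp

lemma g_sum_left: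
  "(\<And>i. i \<in> I \<Longrightarrow> u i \<in> T p) \<Longrightarrow> v \<in> T p \<Longrightarrow> g p (\<Sum>i\<in>I. u i) v = (\<Sum>i\<in>I. g p (u i) v)"
  by (induction I rule: infinite_finite_induct) auto

lemma g_sum_right:
  "(\<And>i. i \<in> I \<Longrightarrow> u i \<in> T p) \<Longrightarrow> v \<in> T p \<Longrightarrow> g p v (\<Sum>i\<in>I. u i) = (\<Sum>i\<in>I. g p v (u i))"
  by (induction I rule: infinite_finite_induct) auto

lemma sf_g: "open U \<Longrightarrow> X \<in> VF U \<Longrightarrow> Y \<in> VF U \<Longrightarrow> (\<lambda>p. g p (X p) (Y p)) \<in> SF U"
  using metric unfolding riemannian_metric_def by auto

lemma connection:
  assumes "open U" "X \<in> VF U" "Y \<in> VF U"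
  shows vf_D: "D X Y \<in> VF U"
    and "Z \<in> VF U \<Longrightarrow> p \<in> U \<Longrightarrow> D (X + Z) Y p = D X Y p + D Z Y p"
    and "Z \<in> VF U \<Longrightarrow> p \<in> U \<Longrightarrow> D X (Y + Z) p = D X Y p + D X Z p"
    and D_scale_left: "f \<in> SF U \<Longrightarrow> p \<in> U \<Longrightarrow> D (\<lambda>q. f q \<cdot> X q) Y p = f p \<cdot> D X Y p"
    and D_scale_right: "f \<in> SF U \<Longrightarrow> p \<in> U \<Longrightarrow> D X (\<lambda>q. f q \<cdot> Y q) p = X p f \<cdot> Y p + f p \<cdot> D X Y p"
  using lc assms unfolding levi_civita_def affine_connection_def by blast+

lemma
  assumes "open U" "X \<in> VF U" "Y \<in> VF U" "Z \<in> VF U" "p \<in> U"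
  shows D_add_left: "D (\<lambda>q. X q + Z q) Y p = D X Y p + D Z Y p"
    and D_add_right: "D X (\<lambda>q. Y q + Z q) p = D X Y p + D X Z p"
  using connection(2,3)[OF assms] by (simp_all add: plus_fun_def)

lemma D_metric:
  assumes "open U" "X \<in> VF U" "Y \<in> VF U" "Z \<in> VF U" "p \<in> U"
  shows "X p (\<lambda>q. g q (Y q) (Z q)) = g p (D X Y p) (Z p) + g p (Y p) (D X Z p)"
  using lc assms unfolding levi_civita_def by blast

lemma bracket_D:
  assumes "open U" "X \<in> VF U" "Y \<in> VF U" "p \<in> U"
  shows "Br X Y p = D X Y p - D Y X p"
proof -
  have "D X Y p - D Y X p = Br X Y p" using lc assms unfolding levi_civita_def by blast
  then show ?thesis by simp
qed

lemma D_tangent [intro]: "open U \<Longrightarrow> X \<in> VF U \<Longrightarrow> Y \<in> VF U \<Longrightarrow> p \<in> U \<Longrightarrow> D X Y p \<in> T p"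
  using vf_D vf_tangent by blast

text \<open>Multiplication by the indicator function of \<open>U\<close> makes the connection a local operator.\<close>

lemma D_cong:
  assumes U: "open U" and X: "X \<in> VF U" and Y: "Y \<in> VF U" and p: "p \<in> U"
    and eq: "\<And>q. q \<in> U \<Longrightarrow> X q = X' q" "\<And>q. q \<in> U \<Longrightarrow> Y q = Y' q"
  shows "D X Y p = D X' Y' p"
proof -
  define i where "i = (\<lambda>q. if q \<in> U then 1 else 0 :: real)"
  have i: "i \<in> SF U" by (rule sf_cong[OF U sf_const[of 1]]) (simp add: i_def)
  have X': "X' \<in> VF U" and Y': "Y' \<in> VF U" using vf_cong X Y eq by blast+
  have ip: "i p = 1" using p by (simp add: i_def)
  have i0: "X' p i = 0"
    using tangent_fun_cong[OF vf_tangent[OF X' p] U p sf_const[of 1], of i]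
      tangent_fun_const[OF vf_tangent[OF X' p], of 1]
    by (simp add: i_def)
  have "(\<lambda>q. i q \<cdot> X q) = (\<lambda>q. i q \<cdot> X' q)" "(\<lambda>q. i q \<cdot> Y q) = (\<lambda>q. i q \<cdot> Y' q)"
    using eq by (auto simp: i_def)
  then have "D X Y p = D X' Y p" "D X' Y p = D X' Y' p"
    using D_scale_left[OF U X Y i p] D_scale_left[OF U X' Y i p]
      D_scale_right[OF U X' Y i p] D_scale_right[OF U X' Y' i p] by (simp_all add: ip i0)
  then show ?thesis by simp
qed

lemma D_zero_left: "open U \<Longrightarrow> Y \<in> VF U \<Longrightarrow> p \<in> U \<Longrightarrow> D (\<lambda>q. 0) Y p = 0"
  using D_scale_left[OF _ vf_zero _ sf_const[of 0], of U Y p] by simp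

lemma D_zero_right: "open U \<Longrightarrow> X \<in> VF U \<Longrightarrow> p \<in> U \<Longrightarrow> D X (\<lambda>q. 0) p = 0"
  using D_scale_right[OF _ _ vf_zero sf_const[of 0], of U X p] by simp

lemma D_sum_left:
  assumes "open U" "\<And>i. i \<in> I \<Longrightarrow> X i \<in> VF U" "Y \<in> VF U" "p \<in> U"
  shows "D (\<lambda>q. \<Sum>i\<in>I. X i q) Y p = (\<Sum>i\<in>I. D (X i) Y p)"
  using assms(2)
proof (induction I rule: infinite_finite_induct)
  case (insert i I)
  then show ?case
    using D_add_left[OF assms(1) _ assms(3) vf_sum[of I X] assms(4), of "X i"]
    by (simp only: sum.insert[OF insert.hyps] insertI1 insertI2)
qed (simp_all add: D_zero_left[OF assms(1,3,4)])

lemma D_sum_right: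
  assumes "open U" "\<And>i. i \<in> I \<Longrightarrow> Y i \<in> VF U" "X \<in> VF U" "p \<in> U"
  shows "D X (\<lambda>q. \<Sum>i\<in>I. Y i q) p = (\<Sum>i\<in>I. D X (Y i) p)"
  using assms(2)
proof (induction I rule: infinite_finite_induct)
  case (insert i I)
  then show ?case
    using D_add_right[OF assms(1) assms(3) _ vf_sum[of I Y] assms(4), of "Y i"]
    by (simp only: sum.insert[OF insert.hyps] insertI1 insertI2)
qed (simp_all add: D_zero_right[OF assms(1,3,4)])

lemma D_diff_left:
  assumes "open U" "X \<in> VF U" "Y \<in> VF U" "Z \<in> VF U" "p \<in> U"
  shows "D (\<lambda>q. X q - Z q) Y p = D X Y p - D Z Y p"
  using D_add_left[OF assms(1,2,3) vf_uminus[OF assms(4)] assms(5)]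
    D_scale_left[OF assms(1,4,3) sf_const[of "-1"] assms(5)] by simp

lemma D_uminus_right:
  assumes "open U" "X \<in> VF U" "Y \<in> VF U" "p \<in> U"
  shows "D X (\<lambda>q. - Y q) p = - D X Y p"
  using D_scale_right[OF assms(1,2,3) sf_const[of "-1"] assms(4)]
    tangent_fun_const[OF vf_tangent[OF assms(2,4)]] by simp

text \<open>Torsion-freeness writes the bracket as \<open>D X Y - D Y X\<close>; this spares a
  direct proof that the commutator of two derivations is the velocity of a curve.\<close>

lemma vf_bracket:
  assumes "open U" "X \<in> VF U" "Y \<in> VF U"
  shows "Br X Y \<in> VF U"
  by (rule vf_cong[OF vf_diff[OF vf_D[OF assms] vf_D[OF assms(1,3,2)]]])
     (use bracket_D[OF assms] in simp)

lemma bracket_apply: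
  "open U \<Longrightarrow> p \<in> U \<Longrightarrow> f \<in> SF U \<Longrightarrow> Br X Y p f = X p (\<lambda>q. Y q f) - Y p (\<lambda>q. X q f)"
  by (auto simp: lie_bracket_def dest: nearI)

lemma bracket_scale_left:
  assumes "open U" "X \<in> VF U" "Y \<in> VF U" "f \<in> SF U" "p \<in> U"
  shows "Br (\<lambda>q. f q \<cdot> X q) Y p = f p \<cdot> Br X Y p - Y p f \<cdot> X p"
  using assms
  by (simp add: bracket_D[of U] vf_scale D_scale_left[of U] D_scale_right[of U]
      tscale_right_diff_distrib)

section \<open>Tensoriality of the curvature\<close>

lemma R_tangent [intro]:
  "open U \<Longrightarrow> X \<in> VF U \<Longrightarrow> Y \<in> VF U \<Longrightarrow> Z \<in> VF U \<Longrightarrow> p \<in> U \<Longrightarrow> R X Y Z p \<in> T p"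
  unfolding curvature_def by (blast intro: vf_D vf_bracket)

lemma R_cong:
  assumes U: "open U" and X: "X \<in> VF U" "X' \<in> VF U" and Y: "Y \<in> VF U" "Y' \<in> VF U"
    and Z: "Z \<in> VF U" "Z' \<in> VF U" and p: "p \<in> U"
    and eq: "\<And>q. q \<in> U \<Longrightarrow> X q = X' q" "\<And>q. q \<in> U \<Longrightarrow> Y q = Y' q" "\<And>q. q \<in> U \<Longrightarrow> Z q = Z' q"
  shows "R X Y Z p = R X' Y' Z' p"
proof -
  have 1: "D X (D Y Z) p = D X' (D Y' Z') p"
    by (rule D_cong[OF U X(1) vf_D[OF U Y(1) Z(1)] p eq(1) D_cong[OF U Y(1) Z(1) _ eq(2,3)]])
  have 2: "D Y (D X Z) p = D Y' (D X' Z') p"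
    by (rule D_cong[OF U Y(1) vf_D[OF U X(1) Z(1)] p eq(2) D_cong[OF U X(1) Z(1) _ eq(1,3)]])
  have 3: "Br X Y q = Br X' Y' q" if "q \<in> U" for q
    using D_cong[OF U X(1) Y(1) that eq(1,2)] D_cong[OF U Y(1) X(1) that eq(2,1)]
    by (simp add: bracket_D[OF U X(1) Y(1) that] bracket_D[OF U X(2) Y(2) that])
  have "D (Br X Y) Z p = D (Br X' Y') Z' p"
    by (rule D_cong[OF U vf_bracket[OF U X(1) Y(1)] Z(1) p 3 eq(3)])
  then show ?thesis using 1 2 by (simp add: curvature_def)
qed

text \<open>The bracket changes sign and the two iterated derivatives trade places. With it,
  linearity in the first slot also serves for the second.\<close>

lemma R_antisym:
  assumes U: "open U" and "X \<in> VF U" "Y \<in> VF U" "Z \<in> VF U" and p: "p \<in> U"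
  shows "R X Y Z p = - R Y X Z p"
proof -
  have "D (Br X Y) Z p = D (\<lambda>q. - Br Y X q) Z p"
    using assms by (intro D_cong[OF U]) (auto simp: bracket_D[of U] intro: vf_bracket)
  also have "\<dots> = - D (Br Y X) Z p"
    using D_scale_left[OF U vf_bracket[OF U assms(3,2)] assms(4) sf_const[of "-1"] p] by simp
  finally show ?thesis by (simp add: curvature_def)
qed

text \<open>The term \<open>Y p f \<cdot> D X Z p\<close> arises twice with opposite signs, from the
  second iterated derivative and from the bracket.\<close>

lemma R_scale_1:
  assumes U: "open U" and X: "X \<in> VF U" and Y: "Y \<in> VF U" and Z: "Z \<in> VF U" and f: "f \<in> SF U" and p: "p \<in> U"
  shows "R (\<lambda>q. f q \<cdot> X q) Y Z p = f p \<cdot> R X Y Z p"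
proof -
  note [simp] = vf_D[OF U] vf_bracket[OF U] X Y Z vf_scale vf_diff vf_apply[OF _ U] f p
  have 1: "D (\<lambda>q. f q \<cdot> X q) (D Y Z) p = f p \<cdot> D X (D Y Z) p"
    by (rule D_scale_left[OF U]) simp_all
  have "D Y (D (\<lambda>q. f q \<cdot> X q) Z) p = D Y (\<lambda>q. f q \<cdot> D X Z q) p"
    by (rule D_cong[OF U]) (simp_all add: D_scale_left[OF U])
  also have "\<dots> = Y p f \<cdot> D X Z p + f p \<cdot> D Y (D X Z) p"
    by (rule D_scale_right[OF U]) simp_all
  finally have 2: "D Y (D (\<lambda>q. f q \<cdot> X q) Z) p = \<dots>" .
  have "D (Br (\<lambda>q. f q \<cdot> X q) Y) Z p = D (\<lambda>q. f q \<cdot> Br X Y q - Y q f \<cdot> X q) Z p"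
    by (rule D_cong[OF U]) (simp_all add: bracket_scale_left[OF U])
  also have "\<dots> = f p \<cdot> D (Br X Y) Z p - Y p f \<cdot> D X Z p"
    by (simp add: D_diff_left[OF U] D_scale_left[OF U])
  finally show ?thesis
    unfolding curvature_def 1 2 by (simp add: tscale_right_diff_distrib)
qed

lemma R_add_1:
  assumes U: "open U" and X: "X \<in> VF U" "X' \<in> VF U" and Y: "Y \<in> VF U" and Z: "Z \<in> VF U" and p: "p \<in> U"
  shows "R (\<lambda>q. X q + X' q) Y Z p = R X Y Z p + R X' Y Z p"
proof -
  note [simp] = vf_D[OF U] vf_bracket[OF U] X Y Z vf_add p
  have 1: "D Y (D (\<lambda>q. X q + X' q) Z) p = D Y (\<lambda>q. D X Z q + D X' Z q) p"
    by (rule D_cong[OF U]) (simp_all add: D_add_left[OF U])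
  have 2: "D (Br (\<lambda>q. X q + X' q) Y) Z p = D (\<lambda>q. Br X Y q + Br X' Y q) Z p"
    by (rule D_cong[OF U]) (simp_all add: bracket_D[OF U] D_add_left[OF U] D_add_right[OF U])
  show ?thesis
    unfolding curvature_def 1 2 by (simp add: D_add_left[OF U] D_add_right[OF U])
qed

text \<open>Terms with first derivatives of \<open>f\<close> are symmetric in \<open>X\<close> and
  \<open>Y\<close> or cancel with the bracket; the second derivatives of \<open>f\<close> combine to
  [X, Y] f, which the bracket term removes.\<close>

lemma R_scale_3:
  assumes U: "open U" and X: "X \<in> VF U" and Y: "Y \<in> VF U" and Z: "Z \<in> VF U" and f: "f \<in> SF U" and p: "p \<in> U"
  shows "R X Y (\<lambda>q. f q \<cdot> Z q) p = f p \<cdot> R X Y Z p"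
proof -
  note [simp] = vf_D[OF U] vf_bracket[OF U] vf_scale vf_add vf_apply[OF _ U] f p
  have 1: "D X (D Y (\<lambda>q. f q \<cdot> Z q)) p =
      X p (\<lambda>q. Y q f) \<cdot> Z p + Y p f \<cdot> D X Z p + X p f \<cdot> D Y Z p + f p \<cdot> D X (D Y Z) p"
    if [simp]: "X \<in> VF U" "Y \<in> VF U" for X Y
  proof -
    note [simp] = Z
    have "D X (D Y (\<lambda>q. f q \<cdot> Z q)) p = D X (\<lambda>q. Y q f \<cdot> Z q + f q \<cdot> D Y Z q) p"
      by (rule D_cong[OF U]) (simp_all add: D_scale_right[OF U])
    also have "\<dots> = D X (\<lambda>q. Y q f \<cdot> Z q) p + D X (\<lambda>q. f q \<cdot> D Y Z q) p"
      by (simp add: D_add_right[OF U])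
    also have "\<dots> = X p (\<lambda>q. Y q f) \<cdot> Z p + Y p f \<cdot> D X Z p + X p f \<cdot> D Y Z p + f p \<cdot> D X (D Y Z) p"
      using D_scale_right[OF U, of X Z "\<lambda>q. Y q f" p] by (simp add: D_scale_right[OF U])
    finally show ?thesis .
  qed
  have 2: "D (Br X Y) (\<lambda>q. f q \<cdot> Z q) p = (X p (\<lambda>q. Y q f) - Y p (\<lambda>q. X q f)) \<cdot> Z p + f p \<cdot> D (Br X Y) Z p"
    using D_scale_right[OF U vf_bracket[OF U X Y] Z f p] bracket_apply[OF U p f, of X Y] by simp
  show ?thesis
    unfolding curvature_def 1[OF X Y] 1[OF Y X] 2 by (simp add: fun_eq_iff algebra_simps)
qed

lemma R_add_3:
  assumes U: "open U" and X: "X \<in> VF U" and Y: "Y \<in> VF U" and Z: "Z \<in> VF U" "Z' \<in> VF U" and p: "p \<in> U"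
  shows "R X Y (\<lambda>q. Z q + Z' q) p = R X Y Z p + R X Y Z' p"
proof -
  note [simp] = vf_D[OF U] vf_bracket[OF U] X Y Z vf_add p
  have 1: "D Y (D X (\<lambda>q. Z q + Z' q)) p = D Y (\<lambda>q. D X Z q + D X Z' q) p"
    by (rule D_cong[OF U]) (simp_all add: D_add_right[OF U])
  have 2: "D X (D Y (\<lambda>q. Z q + Z' q)) p = D X (\<lambda>q. D Y Z q + D Y Z' q) p"
    by (rule D_cong[OF U]) (simp_all add: D_add_right[OF U])
  show ?thesis
    unfolding curvature_def 1 2 by (simp add: D_add_right[OF U])
qed

lemma R_sum_1:
  assumes U: "open U" and X: "\<And>i. i \<in> I \<Longrightarrow> X i \<in> VF U" and Y: "Y \<in> VF U" and Z: "Z \<in> VF U" and p: "p \<in> U"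
  shows "R (\<lambda>q. \<Sum>i\<in>I. X i q) Y Z p = (\<Sum>i\<in>I. R (X i) Y Z p)"
proof -
  have 0: "R (\<lambda>q. 0) Y Z p = 0"
    using R_scale_1[OF U vf_zero Y Z sf_const[of 0] p] by simp
  show ?thesis using X
  proof (induction I rule: infinite_finite_induct)
    case (insert i I)
    then show ?case using R_add_1[OF U _ vf_sum[of I X] Y Z p, of "X i"]
      by (simp only: sum.insert[OF insert.hyps] insertI1 insertI2)
  qed (simp_all add: 0)
qed

lemma R_sum_3:
  assumes U: "open U" and X: "X \<in> VF U" and Y: "Y \<in> VF U" and Z: "\<And>i. i \<in> I \<Longrightarrow> Z i \<in> VF U" and p: "p \<in> U"
  shows "R X Y (\<lambda>q. \<Sum>i\<in>I. Z i q) p = (\<Sum>i\<in>I. R X Y (Z i) p)"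
proof -
  have 0: "R X Y (\<lambda>q. 0) p = 0"
    using R_scale_3[OF U X Y vf_zero sf_const[of 0] p] by simp
  show ?thesis using Z
  proof (induction I rule: infinite_finite_induct)
    case (insert i I)
    then show ?case using R_add_3[OF U X Y _ vf_sum[of I Z] p, of "Z i"]
      by (simp only: sum.insert[OF insert.hyps] insertI1 insertI2)
  qed (simp_all add: 0)
qed

text \<open>Torsion-freeness turns the two brackets into covariant derivatives, and metric
  compatibility cancels the terms in \<open>D V X\<close> and \<open>D V Y\<close>.\<close>

lemma lie_deriv_metric_D:
  assumes U: "open U" and V: "V \<in> VF U" and X: "X \<in> VF U" and Y: "Y \<in> VF U" and p: "p \<in> U"
  shows "lie_deriv_metric A g V X Y p = g p (D X V p) (Y p) + g p (X p) (D Y V p)"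
  unfolding lie_deriv_metric_def D_metric[OF U V X Y p] bracket_D[OF U V X p] bracket_D[OF U V Y p]
  using assms by (simp add: D_tangent vf_tangent)

end

section \<open>Orthonormal frames\<close>

locale orthonormal_frame = riemannian_manifold A g D
  for A :: "('a::t2_space, 'n::finite) atlas" and g D +
  fixes U :: "'a set" and e :: "'n \<Rightarrow> 'a vfield"
  assumes U [simp]: "open U"
    and e [simp]: "e i \<in> VF U"
    and orthonormal: "q \<in> U \<Longrightarrow> g q (e i q) (e j q) = (if i = j then 1 else 0)"
begin

lemma restrict: "open U' \<Longrightarrow> U' \<subseteq> U \<Longrightarrow> orthonormal_frame A g D U' e"
  by unfold_locales (use vf_subset[OF e] orthonormal in \<open>auto simp: subset_iff\<close>)

lemma e_tangent [simp, intro]: "q \<in> U \<Longrightarrow> e i q \<in> T q"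
  using e by (rule vf_tangent)

lemma tangent_expand:
  assumes q: "q \<in> U" and v: "v \<in> T q"
  shows "v = (\<Sum>i\<in>UNIV. g q v (e i q) \<cdot> e i q)"
proof -
  define w where "w = v - (\<Sum>i\<in>UNIV. g q v (e i q) \<cdot> e i q)"
  have w: "w \<in> T q" using q v by (auto simp: w_def)
  have we: "g q w (e j q) = 0" for j
    using q v by (simp add: w_def g_sum_left orthonormal if_distrib cong: if_cong)
  \<comment> \<open>The index type \<open>'n option\<close> has one element more than
    \<open>'n\<close>; the extra index carries the part of \<open>v\<close> orthogonal to the frame,
    so that a linear dependence must exist.\<close>
  define u where "u = (\<lambda>i. case i of None \<Rightarrow> w | Some i \<Rightarrow> e i q)"
  have "u i \<in> T q" for i using q w by (auto simp: u_def split: option.split)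
  then obtain c where c: "c \<noteq> (\<lambda>i. 0)" "(\<Sum>i\<in>UNIV. c i \<cdot> u i) = 0"
    using tangent_dependent[of u q] by auto
  have s: "c None \<cdot> w + (\<Sum>i\<in>UNIV. c (Some i) \<cdot> e i q) = 0"
    using c(2) by (simp add: UNIV_option_conv sum.reindex u_def)
  have "c (Some j) = 0" for j
  proof -
    have "g q (c None \<cdot> w + (\<Sum>i\<in>UNIV. c (Some i) \<cdot> e i q)) (e j q) = c (Some j)"
      using q w by (simp add: we g_sum_left orthonormal if_distrib cong: if_cong)
    then show ?thesis using s q by simp
  qed
  moreover from this have "c None \<noteq> 0" using c(1) by (metis (no_types) ext not_None_eq)
  ultimately have "w = 0"
    using s tscale_tscale[of "1 / c None" "c None" w] by simp
  then show ?thesis by (simp add: w_def)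
qed

lemma vf_expand:
  "X \<in> VF W \<Longrightarrow> q \<in> U \<inter> W \<Longrightarrow> X q = (\<Sum>i\<in>UNIV. g q (X q) (e i q) \<cdot> e i q)"
  using tangent_expand vf_tangent by blast

lemma sf_comp [simp]: "X \<in> VF U \<Longrightarrow> (\<lambda>q. g q (X q) (e i q)) \<in> SF U"
  by (rule sf_g) simp_all

lemma tangent_eqI:
  assumes "q \<in> U" "u \<in> T q" "v \<in> T q" "\<And>i. g q u (e i q) = g q v (e i q)"
  shows "u = v"
  using tangent_expand[OF assms(1,2)] tangent_expand[OF assms(1,3)] assms(4) by simp

lemma R_expand_1:
  assumes "X \<in> VF U" "Y \<in> VF U" "Z \<in> VF U" "p \<in> U"
  shows "R X Y Z p = (\<Sum>i\<in>UNIV. g p (X p) (e i p) \<cdot> R (e i) Y Z p)"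
proof -
  have "R X Y Z p = R (\<lambda>q. \<Sum>i\<in>UNIV. g q (X q) (e i q) \<cdot> e i q) Y Z p"
    by (rule R_cong[OF U]) (use assms vf_expand[of X U] in \<open>auto intro!: vf_sum vf_scale\<close>)
  then show ?thesis
    using assms by (simp add: R_sum_1[OF U] R_scale_1[OF U] vf_scale)
qed

lemma R_expand_3:
  assumes "X \<in> VF U" "Y \<in> VF U" "Z \<in> VF U" "p \<in> U"
  shows "R X Y Z p = (\<Sum>i\<in>UNIV. g p (Z p) (e i p) \<cdot> R X Y (e i) p)"
proof -
  have "R X Y Z p = R X Y (\<lambda>q. \<Sum>i\<in>UNIV. g q (Z q) (e i q) \<cdot> e i q) p"
    by (rule R_cong[OF U]) (use assms vf_expand[of Z U] in \<open>auto intro!: vf_sum vf_scale\<close>)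
  then show ?thesis
    using assms by (simp add: R_sum_3[OF U] R_scale_3[OF U] vf_scale)
qed

text \<open>The third slot is expanded, then the second through antisymmetry, then the
  first.\<close>

lemma R_zeroI:
  assumes "X \<in> VF U" "Y \<in> VF U" "Z \<in> VF U" "p \<in> U" and R0: "\<And>i j k. R (e i) (e j) (e k) p = 0"
  shows "R X Y Z p = 0"
proof -
  have "R (e i) (e j) Z p = 0" for i j using assms R_expand_3[of "e i" "e j" Z p] by simp
  then have "R (e i) Y Z p = 0" for i
    using assms R_antisym[OF U, of "e i" Y Z p] R_antisym[OF U, of _ "e i" Z p] R_expand_1[of Y "e i" Z p] by simp
  then show ?thesis using assms R_expand_1[of X Y Z p] by simp
qed

section \<open>The Ricci tensor in an arbitrary orthonormal frame\<close>

lemma trace_independent: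
  assumes E: "orthonormal_frame A g D U E" and "X \<in> VF U" "Y \<in> VF U" "p \<in> U"
  shows "(\<Sum>i\<in>UNIV. g p (R (e i) X Y p) (e i p)) = (\<Sum>i\<in>UNIV. g p (R (E i) X Y p) (E i p))"
proof -
  interpret E: orthonormal_frame A g D U E by (rule E)
  have T: "R (E j) X Y p \<in> T p" for j using R_tangent[OF U E.e assms(2-4)] .
  \<comment> \<open>The first slot is expanded in \<open>E\<close>; after exchanging the sums, the
    coefficients reassemble \<open>E j p\<close> in the other factor.\<close>
  have "(\<Sum>i\<in>UNIV. g p (R (e i) X Y p) (e i p)) =
      (\<Sum>i\<in>UNIV. \<Sum>j\<in>UNIV. g p (e i p) (E j p) * g p (R (E j) X Y p) (e i p))"
    using assms T by (simp add: E.R_expand_1[of "e _"] g_sum_left)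
  also have "\<dots> = (\<Sum>j\<in>UNIV. \<Sum>i\<in>UNIV. g p (E j p) (e i p) * g p (R (E j) X Y p) (e i p))"
    using assms by (subst sum.swap) (simp add: g_sym[of "E _ p"])
  also have "\<dots> = (\<Sum>j\<in>UNIV. g p (R (E j) X Y p) (\<Sum>i\<in>UNIV. g p (E j p) (e i p) \<cdot> e i p))"
    using assms T by (simp add: g_sum_right)
  also have "\<dots> = (\<Sum>j\<in>UNIV. g p (R (E j) X Y p) (E j p))"
    using tangent_expand[of p "E _ p"] assms by simp
  finally show ?thesis .
qed

text \<open>\<open>ricci\<close> and \<open>scalar_curvature\<close> use a frame picked by
  \<open>SOME\<close>. Since \<open>e\<close> is a candidate, the chosen family is a genuine
  orthonormal frame on some neighbourhood.\<close>

lemma some_frame: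
  assumes "p \<in> U"
  obtains U' where "p \<in> U'" "orthonormal_frame A g D U' (SOME E. orthonormal_frame_at A g p E)"
proof -
  have "orthonormal_frame_at A g p e"
    unfolding orthonormal_frame_at_def using assms orthonormal by (intro exI[of _ U]) auto
  then have "orthonormal_frame_at A g p (SOME E. orthonormal_frame_at A g p E)"
    by (rule someI[where P = "orthonormal_frame_at A g p"])
  then obtain U' where U': "open U'" "p \<in> U'" "\<And>i. (SOME E. orthonormal_frame_at A g p E) i \<in> VF U'"
     "\<And>q i j. q \<in> U' \<Longrightarrow> g q ((SOME E. orthonormal_frame_at A g p E) i q)
        ((SOME E. orthonormal_frame_at A g p E) j q) = (if i = j then 1 else 0)"
    unfolding orthonormal_frame_at_def by blast
  then show ?thesis by (intro that[of U']) (unfold_locales, auto)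
qed

text \<open>The two traces are compared on the common domain of both frames and of \<open>X\<close>,
  \<open>Y\<close>. From here on \<open>Ric\<close> may be computed in any convenient frame.\<close>

lemma ricci_frame:
  assumes W: "open W" "X \<in> VF W" "Y \<in> VF W" "p \<in> U \<inter> W"
  shows "Ric X Y p = (\<Sum>i\<in>UNIV. g p (R (e i) X Y p) (e i p))"
proof -
  obtain U' where U': "p \<in> U'" "orthonormal_frame A g D U' (SOME E. orthonormal_frame_at A g p E)"
    using some_frame assms by blast
  let ?U = "U \<inter> U' \<inter> W"
  have oU': "open U'" using U'(2) by (rule orthonormal_frame.U)
  interpret e: orthonormal_frame A g D ?U e using restrict[of ?U] oU' W by (auto simp: open_Int)
  have "orthonormal_frame A g D ?U (SOME E. orthonormal_frame_at A g p E)"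
    using orthonormal_frame.restrict[OF U'(2), of ?U] oU' W by (auto simp: open_Int)
  from e.trace_independent[OF this, of X Y p] show ?thesis
    using assms U' vf_subset[of _ W ?U] by (simp add: ricci_def Let_def)
qed

lemma ricci_expand:
  assumes W: "open W" "X \<in> VF W" "Y \<in> VF W" "p \<in> U \<inter> W"
  shows "Ric X Y p = (\<Sum>j\<in>UNIV. g p (Y p) (e j p) * Ric X (e j) p)"
proof -
  let ?U = "U \<inter> W"
  interpret e: orthonormal_frame A g D ?U e using restrict[of ?U] W by (auto simp: open_Int)
  have X: "X \<in> VF ?U" "Y \<in> VF ?U" using W vf_subset by auto
  have "Ric X Y p = (\<Sum>i\<in>UNIV. \<Sum>j\<in>UNIV. g p (Y p) (e j p) * g p (R (e i) X (e j) p) (e i p))"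
    using X assms R_tangent[OF e.U e.e X(1) e.e] by (simp add: e.ricci_frame[OF e.U X] e.R_expand_3[of "e _" X Y] g_sum_left)
  also have "\<dots> = (\<Sum>j\<in>UNIV. g p (Y p) (e j p) * Ric X (e j) p)"
    using X W by (subst sum.swap) (simp add: e.ricci_frame[OF e.U X(1) e.e] sum_distrib_left)
  finally show ?thesis .
qed

text \<open>The vector with frame components \<open>Ric X (e j) p\<close> meets the description
  behind \<open>THE\<close>, and testing against the frame fields gives uniqueness.\<close>

lemma ricci_operator_spec:
  assumes "open W" "X \<in> VF W" "Y \<in> VF W" "p \<in> U \<inter> W"
  shows "Ric X Y p = g p (ricci_operator A g D X p) (Y p)"
proof -
  let ?P = "\<lambda>v. v \<in> T p \<and> (\<forall>U. open U \<and> p \<in> U \<longrightarrow> (\<forall>Y\<in>VF U. Ric X Y p = g p v (Y p)))"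
  define w where "w = (\<Sum>j\<in>UNIV. Ric X (e j) p \<cdot> e j p)"
  have p: "p \<in> U" using assms by simp
  have w: "w \<in> T p" using p by (auto simp: w_def)
  have "Ric X Y p = g p w (Y p)" if "open U'" "p \<in> U'" "Y \<in> VF U'" for U' Y
  proof -
    have "Y p \<in> T p" using that by blast
    then have "g p w (Y p) = (\<Sum>j\<in>UNIV. g p (Y p) (e j p) * Ric X (e j) p)"
      using p by (simp add: w_def g_sum_left g_sym[of "Y p"] mult.commute)
    then show ?thesis
      using ricci_expand[of "W \<inter> U'" X Y p] that assms vf_subset[of X W "W \<inter> U'"] vf_subset[of Y U' "W \<inter> U'"]
      by (auto simp: open_Int)
  qed
  then have "?P w" using w by blast
  moreover have "v = w" if "?P v" for v
    using tangent_eqI[OF p, of v w] that \<open>?P w\<close> p U e by metis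
  ultimately have "?P (ricci_operator A g D X p)"
    unfolding ricci_operator_def by (rule theI)
  then show ?thesis using assms by blast
qed

section \<open>Connection coefficients and structure functions of a frame\<close>

definition G :: "'n \<Rightarrow> 'n \<Rightarrow> 'n \<Rightarrow> 'a \<Rightarrow> real" where
  "G i j k q = g q (D (e i) (e j) q) (e k q)"

lemma sf_G [simp]: "G i j k \<in> SF U"
  unfolding G_def[abs_def] by (simp add: vf_D[OF U])

lemma G_antisym:
  assumes "q \<in> U" shows "G i j k q = - G i k j q"
proof -
  have "e i q (\<lambda>q. g q (e j q) (e k q)) = 0"
    using tangent_fun_cong[OF e_tangent[OF assms, of i] U assms sf_const[of "if j = k then 1 else 0"], of "\<lambda>q. g q (e j q) (e k q)"]
      tangent_fun_const[OF e_tangent[OF assms, of i], of "if j = k then 1 else 0"] orthonormal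
    by simp
  then show ?thesis
    using D_metric[OF U e e e assms, of i j k] assms D_tangent[OF U e e assms]
    by (simp add: G_def g_sym[of "e j q"])
qed

lemma G_same [simp]: "q \<in> U \<Longrightarrow> G i j j q = 0"
  using G_antisym[of q i j j] by simp

lemma D_frame: "q \<in> U \<Longrightarrow> D (e i) (e j) q = (\<Sum>k\<in>UNIV. G i j k q \<cdot> e k q)"
  unfolding G_def using tangent_expand[OF _ D_tangent[OF U e e]] by simp

lemma bracket_frame:
  "q \<in> U \<Longrightarrow> Br (e i) (e j) q = (\<Sum>k\<in>UNIV. (G i j k q - G j i k q) \<cdot> e k q)"
  by (simp add: bracket_D[OF U e e] D_frame tscale_left_diff_distrib sum_subtractf)

lemma commutator:
  assumes "open W" "W \<subseteq> U" "f \<in> SF W" "p \<in> W"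
  shows "e i p (\<lambda>q. e j q f) - e j p (\<lambda>q. e i q f) = (\<Sum>m\<in>UNIV. (G i j m p - G j i m p) * e m p f)"
  using bracket_apply[OF assms(1,4,3), of "e i" "e j"] bracket_frame[of p i j] assms
  by (auto simp: tvec_sum_apply)

text \<open>The last product comes from the bracket term, the rest from the Leibniz rule. Once the
  derivatives of \<open>G\<close> are known, every curvature computation becomes algebra.\<close>

lemma R_frame:
  assumes p: "p \<in> U"
  shows "g p (R (e i) (e j) (e k) p) (e l p) =
    e i p (G j k l) - e j p (G i k l)
    + (\<Sum>m\<in>UNIV. G j k m p * G i m l p - G i k m p * G j m l p - (G i j m p - G j i m p) * G m k l p)"
proof -
  have DD: "D (e i) (D (e j) (e k)) p = (\<Sum>m\<in>UNIV. e i p (G j k m) \<cdot> e m p + G j k m p \<cdot> D (e i) (e m) p)" for i j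
  proof -
    have "D (e i) (D (e j) (e k)) p = D (e i) (\<lambda>q. \<Sum>m\<in>UNIV. G j k m q \<cdot> e m q) p"
      by (rule D_cong[OF U _ _ p]) (auto simp: D_frame vf_D[OF U])
    then show ?thesis using p by (simp add: D_sum_right[OF U] D_scale_right[OF U] vf_scale)
  qed
  have gDD: "g p (D (e i) (D (e j) (e k)) p) (e l p) = e i p (G j k l) + (\<Sum>m\<in>UNIV. G j k m p * G i m l p)" for i j
    using p D_tangent[OF U e e p]
    by (simp add: DD g_sum_left sum.distrib orthonormal G_def[of _ _ l, symmetric] if_distrib cong: if_cong)
  have "D (Br (e i) (e j)) (e k) p = D (\<lambda>q. \<Sum>m\<in>UNIV. (G i j m q - G j i m q) \<cdot> e m q) (e k) p"
    by (rule D_cong[OF U _ _ p]) (auto simp: bracket_frame vf_bracket[OF U])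
  also have "\<dots> = (\<Sum>m\<in>UNIV. (G i j m p - G j i m p) \<cdot> D (e m) (e k) p)"
    using p by (simp add: D_sum_left[OF U] vf_scale sf_diff[OF U] D_scale_left[OF U])
  finally have "g p (D (Br (e i) (e j)) (e k) p) (e l p) = (\<Sum>m\<in>UNIV. (G i j m p - G j i m p) * G m k l p)"
    using p D_tangent[OF U e e p] by (simp add: g_sum_left G_def[of _ _ l, symmetric])
  then show ?thesis
    using p D_tangent[OF U] vf_D[OF U] vf_bracket[OF U] by (simp add: curvature_def gDD sum_subtractf)
qed

text \<open>The structure functions: by torsion-freeness they are the frame components of
  [e_i, e_j].\<close>

abbreviation "C i j k q \<equiv> G i j k q - G j i k q"

text \<open>On a test function the cyclic sum of the double brackets consists of triple derivatives
  that cancel in pairs. Its \<open>e l\<close> component is the integrability condition on the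
  structure functions.\<close>

lemma jacobi:
  assumes p: "p \<in> U"
  shows "(e i p (C j k l) + (\<Sum>m\<in>UNIV. C j k m p * C i m l p))
       + (e j p (C k i l) + (\<Sum>m\<in>UNIV. C k i m p * C j m l p))
       + (e k p (C i j l) + (\<Sum>m\<in>UNIV. C i j m p * C k m l p)) = 0"
proof -
  let ?J = "\<lambda>i j k l. e i p (C j k l) + (\<Sum>m\<in>UNIV. C j k m p * C i m l p)"
  \<comment> \<open>The cyclic sum as a tangent vector, to be tested on functions and then paired
    with the frame.\<close>
  let ?v = "\<Sum>l\<in>UNIV. (?J i j k l + ?J j k i l + ?J k i j l) \<cdot> e l p"
  have v: "?v \<in> T p" using p by auto
  have "?v f = 0" for f
  proof (cases "near p f")
    case False
    then show ?thesis using tangent_fun_not_near[OF v] by blast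
  next
    case True
    then obtain W' where "open W'" "p \<in> W'" "f \<in> SF W'" unfolding smooth_near_def by auto
    then obtain W where W: "open W" "W \<subseteq> U" "p \<in> W" "f \<in> SF W"
      using that[of "W' \<inter> U"] p sf_subset[of f W' "W' \<inter> U"] by (auto simp: open_Int)
    have ef: "(\<lambda>q. e i q h) \<in> SF W" if "h \<in> SF W" for i h
      using vf_apply_subset[OF e W(1,2) that] .
    have GW: "G i j k \<in> SF W" for i j k using sf_subset[OF sf_G W(2)] .
    have ep: "e i p \<in> T p" for i using p by simp
    have nearI': "near p h" if "h \<in> SF W" for h using nearI[OF W(1,3) that] .
    have 1: "e i p (\<lambda>q. e j q (\<lambda>q. e k q f)) - e i p (\<lambda>q. e k q (\<lambda>q. e j q f)) =
        (\<Sum>m\<in>UNIV. C j k m p * e i p (\<lambda>q. e m q f) + e i p (C j k m) * e m p f)" for i j k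
    proof -
      have "e i p (\<lambda>q. e j q (\<lambda>q. e k q f) - e k q (\<lambda>q. e j q f)) =
         e i p (\<lambda>q. \<Sum>m\<in>UNIV. C j k m q * e m q f)"
        by (rule tangent_fun_cong[OF ep W(1,3)])
           (use commutator[OF W(1,2,4)] in \<open>auto intro!: sf_diff ef W\<close>)
      also have "\<dots> = (\<Sum>m\<in>UNIV. e i p (\<lambda>q. C j k m q * e m q f))"
        by (intro tangent_fun_sum[OF ep] nearI' sf_mult sf_diff W ef GW)
      also have "\<dots> = (\<Sum>m\<in>UNIV. C j k m p * e i p (\<lambda>q. e m q f) + e i p (C j k m) * e m p f)"
        by (intro sum.cong refl tangent_fun_mult[OF ep] nearI' sf_diff W ef GW)
      finally show ?thesis
        by (subst (asm) tangent_fun_diff[OF ep]) (auto intro!: nearI' ef W)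
    qed
    have 2: "e j p (\<lambda>q. e k q (\<lambda>q. e i q f)) - e k p (\<lambda>q. e j q (\<lambda>q. e i q f)) =
       (\<Sum>m\<in>UNIV. C j k m p * e m p (\<lambda>q. e i q f))" for i j k
      by (rule commutator[OF W(1,2) ef[OF W(4)] W(3)])
    have 3: "(\<Sum>m\<in>UNIV. C j k m p * e i p (\<lambda>q. e m q f) + e i p (C j k m) * e m p f)
       - (\<Sum>m\<in>UNIV. C j k m p * e m p (\<lambda>q. e i q f)) = (\<Sum>l\<in>UNIV. ?J i j k l * e l p f)" for i j k
    proof -
      have a: "(\<Sum>m\<in>UNIV. C j k m p * e i p (\<lambda>q. e m q f)) - (\<Sum>m\<in>UNIV. C j k m p * e m p (\<lambda>q. e i q f)) =
        (\<Sum>m\<in>UNIV. C j k m p * (\<Sum>l\<in>UNIV. C i m l p * e l p f))"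
        by (simp only: commutator[OF W(1,2,4,3), symmetric] sum_subtractf right_diff_distrib)
      have b: "(\<Sum>m\<in>UNIV. C j k m p * (\<Sum>l\<in>UNIV. C i m l p * e l p f)) =
        (\<Sum>l\<in>UNIV. (\<Sum>m\<in>UNIV. C j k m p * C i m l p) * e l p f)"
        by (simp only: sum_distrib_left sum_distrib_right mult.assoc) (rule sum.swap)
      show ?thesis
        using a unfolding b by (simp add: sum.distrib distrib_right)
    qed
    have v_f: "?v f = (\<Sum>l\<in>UNIV. ?J i j k l * e l p f) + (\<Sum>l\<in>UNIV. ?J j k i l * e l p f) + (\<Sum>l\<in>UNIV. ?J k i j l * e l p f)"
      by (simp only: tvec_sum_apply tscale_apply distrib_right sum.distrib)
    show ?thesis
      unfolding v_f 3[symmetric] 1[symmetric] 2[symmetric] by simp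
  qed
  then have "?v = 0" by (simp add: fun_eq_iff)
  then have "g p ?v (e l p) = 0" using p by simp
  moreover have "g p ?v (e l p) = ?J i j k l + ?J j k i l + ?J k i j l"
    using p by (simp add: g_sum_left orthonormal if_distrib cong: if_cong)
  ultimately show ?thesis by simp
qed

section \<open>The soliton equation in a frame, and rules for differentiating along it\<close>

lemma D_comp:
  assumes V: "V \<in> VF U" and p: "p \<in> U"
  shows "g p (D (e i) V p) (e k p) = e i p (\<lambda>q. g q (V q) (e k q)) + (\<Sum>j\<in>UNIV. g p (V p) (e j p) * G i j k p)"
proof -
  have "g p (V p) (D (e i) (e k) p) = - (\<Sum>j\<in>UNIV. g p (V p) (e j p) * G i j k p)"
    using p vf_tangent[OF V p] G_antisym[OF p, of i k]
    by (simp add: D_frame g_sum_right sum_negf mult.commute)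
  then show ?thesis using D_metric[OF U e V e p, of i k] by simp
qed

lemma lie_deriv_frame:
  assumes V: "V \<in> VF U" and p: "p \<in> U"
  shows "lie_deriv_metric A g V (e i) (e k) p =
    e i p (\<lambda>q. g q (V q) (e k q)) + e k p (\<lambda>q. g q (V q) (e i q))
    + (\<Sum>j\<in>UNIV. g p (V p) (e j p) * (G i j k p + G k j i p))"
  using D_comp[OF V p, of i k] D_comp[OF V p, of k i] p D_tangent[OF U e V p]
  by (simp add: lie_deriv_metric_D[OF U V e e p] g_sym[of "e i p"] distrib_left sum.distrib)

lemma ricci_cong:
  assumes "X \<in> VF U" "X' \<in> VF U" "Y \<in> VF U" "Y' \<in> VF U" "p \<in> U"
    and "\<And>q. q \<in> U \<Longrightarrow> X q = X' q" "\<And>q. q \<in> U \<Longrightarrow> Y q = Y' q"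
  shows "Ric X Y p = Ric X' Y' p"
proof -
  have "R (e i) X Y p = R (e i) X' Y' p" for i
    by (rule R_cong[OF U]) (use assms in auto)
  then show ?thesis using assms ricci_frame[OF U] by simp
qed

lemma e_const:
  assumes "p \<in> U" "\<And>q. q \<in> U \<Longrightarrow> f q = c"
  shows "e i p f = 0"
  using tangent_fun_cong[OF e_tangent[OF assms(1), of i] U assms(1) sf_const[of c], of f]
    tangent_fun_const[OF e_tangent[OF assms(1), of i], of c] assms(2)
  by simp

lemma e_affine:
  assumes p: "p \<in> U" and h: "h \<in> SF U" and f: "\<And>q. q \<in> U \<Longrightarrow> f q = c + d * h q"
  shows "e i p f = d * e i p h"
proof -
  have "e i p f = e i p (\<lambda>q. c + d * h q)"
    by (rule tangent_fun_cong[OF e_tangent[OF p] U p, symmetric])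
       (use f in \<open>auto intro!: sf_add sf_mult sf_const h\<close>)
  also have "\<dots> = e i p (\<lambda>q. c) + e i p (\<lambda>q. d * h q)"
    by (rule tangent_fun_add[OF e_tangent[OF p]]) (auto intro!: nearI[OF U p] sf_mult sf_const h)
  also have "\<dots> = d * e i p h"
    using tangent_fun_cmult[OF e_tangent[OF p] nearI[OF U p h]] tangent_fun_const[OF e_tangent[OF p]] by simp
  finally show ?thesis .
qed

text \<open>The coefficient is affine in \<open>h\<close> and constant along \<open>e i\<close>.
  This is the shape of the mixed soliton equations, with \<open>G 3 1 2\<close> as
  \<open>h\<close>.\<close>

lemma e_prod:
  assumes p: "p \<in> U" and h: "h \<in> SF U" and f': "f' \<in> SF U"
    and f: "\<And>q. q \<in> U \<Longrightarrow> f q = (c + d * h q) * f' q" and h0: "e i p h = 0"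
  shows "e i p f = (c + d * h p) * e i p f'"
proof -
  let ?k = "\<lambda>q. c + d * h q"
  have k: "?k \<in> SF U" by (intro sf_add sf_mult sf_const h U)
  have "e i p f = e i p (\<lambda>q. ?k q * f' q)"
    by (rule tangent_fun_cong[OF e_tangent[OF p] U p, symmetric]) (use f in \<open>auto intro!: sf_mult k f'\<close>)
  also have "\<dots> = ?k p * e i p f' + e i p ?k * f' p"
    by (rule tangent_fun_mult[OF e_tangent[OF p] nearI[OF U p k] nearI[OF U p f']])
  also have "e i p ?k = 0" using e_affine[OF p h, of ?k c d i] h0 by simp
  finally show ?thesis by simp
qed

end

section \<open>Contact metric three-manifolds\<close>

locale contact_manifold = riemannian_manifold A g D
  for A :: "('a::t2_space, 3) atlas" and g D +
  fixes \<phi> :: "'a \<Rightarrow> 'a tvec \<Rightarrow> 'a tvec" and \<xi> :: "'a vfield" and \<eta> :: "'a \<Rightarrow> 'a tvec \<Rightarrow> real"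
  assumes contact: "contact_metric_3 A \<phi> \<xi> \<eta> g"
begin

lemma
  shows endo: "endo_field A \<phi>"
    and xi_global: "\<xi> \<in> VF UNIV"
    and contact_form: "\<forall>p. \<exists>U. open U \<and> p \<in> U \<and>
        (\<exists>X\<in>VF U. \<exists>Y\<in>VF U. \<exists>Z\<in>VF U. wedge_ext_deriv A \<eta> X Y Z p \<noteq> 0)"
    and reeb_unit: "\<forall>p. g p (\<xi> p) (\<xi> p) = 1 \<and> \<eta> p (\<xi> p) = 1"
    and phi_eta: "\<forall>p. \<forall>u\<in>T p. \<eta> p u = g p u (\<xi> p) \<and> \<phi> p (\<phi> p u) = - u + \<eta> p u \<cdot> \<xi> p"
    and dEta: "\<forall>U. open U \<longrightarrow> (\<forall>X\<in>VF U. \<forall>Y\<in>VF U. \<forall>p\<in>U.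
        ext_deriv A \<eta> X Y p = g p (X p) (\<phi> p (Y p)))"
  using contact unfolding contact_metric_3_def by simp_all

lemma xi_vf [simp]: "\<xi> \<in> VF U"
  using xi_global vf_subset by blast

lemma xi_tangent [simp, intro]: "\<xi> p \<in> T p"
  using vf_tangent[OF xi_vf[of UNIV]] by simp

lemma phi_tangent [simp, intro]: "u \<in> T p \<Longrightarrow> \<phi> p u \<in> T p"
  using endo unfolding endo_field_def by blast

lemma phi_add: "u \<in> T p \<Longrightarrow> v \<in> T p \<Longrightarrow> \<phi> p (u + v) = \<phi> p u + \<phi> p v"
  using endo unfolding endo_field_def by blast

lemma phi_scale: "u \<in> T p \<Longrightarrow> \<phi> p (c \<cdot> u) = c \<cdot> \<phi> p u"
  using endo unfolding endo_field_def by blast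

lemma phi_vf [simp]: "open U \<Longrightarrow> X \<in> VF U \<Longrightarrow> (\<lambda>p. \<phi> p (X p)) \<in> VF U"
  using endo unfolding endo_field_def by blast

lemma xi_unit [simp]: "g p (\<xi> p) (\<xi> p) = 1"
  using reeb_unit by blast

lemma eta_eq: "u \<in> T p \<Longrightarrow> \<eta> p u = g p u (\<xi> p)"
  using phi_eta by blast

lemma phi_phi: "u \<in> T p \<Longrightarrow> \<phi> p (\<phi> p u) = - u + g p u (\<xi> p) \<cdot> \<xi> p"
proof -
  assume u: "u \<in> T p"
  then have "\<phi> p (\<phi> p u) = - u + \<eta> p u \<cdot> \<xi> p"
    using phi_eta by blast
  then show ?thesis by (simp only: eta_eq[OF u])
qed

lemma ext_deriv_phi:
  "open U \<Longrightarrow> X \<in> VF U \<Longrightarrow> Y \<in> VF U \<Longrightarrow> p \<in> U \<Longrightarrow> ext_deriv A \<eta> X Y p = g p (X p) (\<phi> p (Y p))"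
  using dEta by blast

lemma vf_apply_eta:
  assumes U: "open U" and X: "X \<in> VF U" and Y: "Y \<in> VF U" and p: "p \<in> U"
  shows "X p (\<lambda>q. \<eta> q (Y q)) = g p (D X Y p) (\<xi> p) + g p (Y p) (D X \<xi> p)"
proof -
  have "X p (\<lambda>q. \<eta> q (Y q)) = X p (\<lambda>q. g q (Y q) (\<xi> q))"
    by (rule tangent_fun_cong[OF vf_tangent[OF X p] U p, symmetric])
       (use Y in \<open>auto simp: eta_eq vf_tangent sf_g[OF U]\<close>)
  then show ?thesis using D_metric[OF U X Y xi_vf p] by simp
qed

text \<open>In 2 d\<eta>(X, Y) the terms with \<open>D X Y\<close> and \<open>D Y X\<close> cancel
  against \<eta> of the bracket, which leaves the antisymmetric part of \<nabla>\<xi>.\<close>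

lemma phi_D_xi:
  assumes U: "open U" and X: "X \<in> VF U" and Y: "Y \<in> VF U" and p: "p \<in> U"
  shows "2 * g p (X p) (\<phi> p (Y p)) = g p (Y p) (D X \<xi> p) - g p (X p) (D Y \<xi> p)"
proof -
  have "\<eta> p (Br X Y p) = g p (D X Y p) (\<xi> p) - g p (D Y X p) (\<xi> p)"
    using eta_eq[OF vf_tangent[OF vf_bracket[OF U X Y] p]] D_tangent[OF U X Y p] D_tangent[OF U Y X p]
    by (simp add: bracket_D[OF U X Y p])
  then show ?thesis
    unfolding ext_deriv_phi[OF assms, symmetric] ext_deriv_def
    using vf_apply_eta[OF U X Y p] vf_apply_eta[OF U Y X p] by simp
qed

text \<open>Inherited from the antisymmetry of d\<eta>.\<close>

lemma phi_skew:
  assumes U: "open U" and X: "X \<in> VF U" and Y: "Y \<in> VF U" and p: "p \<in> U"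
  shows "g p (\<phi> p (X p)) (Y p) = - g p (X p) (\<phi> p (Y p))"
  using phi_D_xi[OF assms] phi_D_xi[OF U Y X p] g_sym[of "\<phi> p (X p)" p "Y p"] vf_tangent[OF X p] vf_tangent[OF Y p]
  by simp

text \<open>By skew-symmetry the squared length of \<phi>\<xi> is - g(\<xi>, \<phi>\<phi>\<xi>), and
  \<phi>\<phi>\<xi> = - \<xi> + \<xi> = 0.\<close>

lemma phi_xi [simp]: "\<phi> p (\<xi> p) = 0"
proof (rule ccontr)
  assume "\<phi> p (\<xi> p) \<noteq> 0"
  then have "g p (\<phi> p (\<xi> p)) (\<phi> p (\<xi> p)) > 0" by (intro g_pos) auto
  moreover have "g p (\<phi> p (\<xi> p)) (\<phi> p (\<xi> p)) = 0"
    using phi_skew[OF _ _ phi_vf, of UNIV \<xi> \<xi> p] by (simp add: phi_phi)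
  ultimately show False by simp
qed

end

section \<open>Orthonormal frames adapted to the contact structure\<close>

locale adapted_frame = contact_manifold A g D \<phi> \<xi> \<eta> + orthonormal_frame A g D U e
  for A :: "('a::t2_space, 3) atlas" and g D \<phi> \<xi> \<eta> U e +
  assumes e3: "q \<in> U \<Longrightarrow> e 3 q = \<xi> q"
    and e2: "q \<in> U \<Longrightarrow> e 2 q = \<phi> q (e 1 q)"

context contact_manifold
begin

lemma adapted_frameI:
  assumes U: "open U" and X: "X \<in> VF U"
    and unit: "\<And>q. q \<in> U \<Longrightarrow> g q (X q) (X q) = 1" and orth: "\<And>q. q \<in> U \<Longrightarrow> g q (X q) (\<xi> q) = 0"
  shows "adapted_frame A g D \<phi> \<xi> \<eta> U (\<lambda>i. if i = 1 then X else if i = 2 then \<lambda>q. \<phi> q (X q) else \<xi>)"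
    (is "adapted_frame _ _ _ _ _ _ _ ?e")
proof unfold_locales
  show "?e i \<in> VF U" for i using X U by simp
  fix q assume q: "q \<in> U"
  have T: "X q \<in> T q" using X q by blast
  have 1: "g q (\<phi> q (X q)) (\<phi> q (X q)) = 1"
    using phi_skew[OF U X phi_vf[OF U X] q] T by (simp add: phi_phi unit[OF q] orth[OF q])
  have 2: "g q (\<phi> q (X q)) (X q) = 0" "g q (X q) (\<phi> q (X q)) = 0"
    using phi_skew[OF U X X q] g_sym[of "X q" q "\<phi> q (X q)"] T by auto
  have 3: "g q (\<phi> q (X q)) (\<xi> q) = 0" "g q (\<xi> q) (\<phi> q (X q)) = 0"
    using phi_skew[OF U X xi_vf q] g_sym[of "\<xi> q" q "\<phi> q (X q)"] T by auto
  have 4: "g q (\<xi> q) (X q) = 0" using orth[OF q] g_sym[of "\<xi> q" q "X q"] T by simp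
  show "g q (?e i q) (?e j q) = (if i = j then 1 else 0)" for i j
    using exhaust_3[of i] exhaust_3[of j] 1 2 3 4 unit[OF q] orth[OF q] by auto
qed (use U in auto)

text \<open>The field is divided by its length on the open set where it does not vanish. The factor
  \<open>N\<close> is returned because the eigenvector construction computes with it.\<close>

lemma adapted_frame_normalize:
  assumes U: "open U" and Y: "Y \<in> VF U" and orth: "\<And>q. q \<in> U \<Longrightarrow> g q (Y q) (\<xi> q) = 0"
    and p: "p \<in> U" "Y p \<noteq> 0"
  obtains U' e N where "p \<in> U'" "U' \<subseteq> U" "adapted_frame A g D \<phi> \<xi> \<eta> U' e" "N \<in> SF U'"
    "\<And>q. q \<in> U' \<Longrightarrow> (N q)\<^sup>2 * g q (Y q) (Y q) = 1"
    "\<And>q. q \<in> U' \<Longrightarrow> e 1 q = N q \<cdot> Y q"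
proof -
  let ?f = "\<lambda>q. g q (Y q) (Y q)"
  let ?N = "\<lambda>q. ?f q powr (-1/2)"
  define U' where "U' = {q \<in> U. ?f q > 0}"
  have f: "?f \<in> SF U" by (rule sf_g[OF U Y Y])
  have U': "open U'" "U' \<subseteq> U" unfolding U'_def using sf_open_pos[OF U f] by auto
  have pU': "p \<in> U'" using p g_pos[of "Y p" p] vf_tangent[OF Y p(1)] by (simp add: U'_def)
  have N: "?N \<in> SF U'" by (rule sf_powr[OF U'(1) sf_subset[OF f U'(2)]]) (simp add: U'_def)
  have N2: "(?N q)\<^sup>2 * ?f q = 1" if "q \<in> U'" for q
  proof -
    have "?f q > 0" using that by (simp add: U'_def)
    then show ?thesis by (simp add: power2_eq_square powr_add[symmetric] powr_minus_divide)
  qed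
  have YT: "Y q \<in> T q" if "q \<in> U'" for q using that U'(2) Y by blast
  have "adapted_frame A g D \<phi> \<xi> \<eta> U' (\<lambda>i. if i = 1 then (\<lambda>q. ?N q \<cdot> Y q)
      else if i = 2 then \<lambda>q. \<phi> q (?N q \<cdot> Y q) else \<xi>)"
  proof (rule adapted_frameI[OF U'(1) vf_scale[OF vf_subset[OF Y U'(2)] N]])
    fix q assume q: "q \<in> U'"
    show "g q (?N q \<cdot> Y q) (?N q \<cdot> Y q) = 1"
      using N2[OF q] YT[OF q] by (simp add: power2_eq_square mult.assoc)
    show "g q (?N q \<cdot> Y q) (\<xi> q) = 0" using orth[of q] q U'(2) YT[OF q] by auto
  qed
  from that[OF pU' U'(2) this N N2] show ?thesis by simp
qed

text \<open>Nondegeneracy of the contact form supplies a local field not parallel to \<xi> at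
  \<open>p\<close>: if \<open>X\<close>, \<open>Y\<close>, \<open>Z\<close> were all multiples of
  \<xi> there, \<phi> would kill them and d\<eta> would vanish on every pair.\<close>

lemma adapted_frame_exists:
  obtains U e where "p \<in> U" "adapted_frame A g D \<phi> \<xi> \<eta> U e"
proof -
  obtain U X Y Z where U: "open U" "p \<in> U" and XYZ: "X \<in> VF U" "Y \<in> VF U" "Z \<in> VF U"
    and w: "wedge_ext_deriv A \<eta> X Y Z p \<noteq> 0"
    using contact_form by metis
  let ?h = "\<lambda>X q. X q - g q (X q) (\<xi> q) \<cdot> \<xi> q"
  have "\<exists>X\<in>{X, Y, Z}. ?h X p \<noteq> 0"
  proof (rule ccontr)
    assume "\<not> ?thesis"
    then have xi: "\<phi> p (V p) = 0" if "V \<in> {X, Y, Z}" for V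
      using that phi_scale[OF xi_tangent, of p "g p (V p) (\<xi> p)"] by auto
    have "ext_deriv A \<eta> V V' p = 0" if "V \<in> {X, Y, Z}" "V' \<in> {X, Y, Z}" for V V'
      using ext_deriv_phi[OF U(1), of V V' p] that XYZ U xi[of V'] vf_tangent[of V U p] by auto
    then have "wedge_ext_deriv A \<eta> X Y Z p = 0" by (simp add: wedge_ext_deriv_def)
    then show False using w by simp
  qed
  then obtain V where V: "V \<in> VF U" "?h V p \<noteq> 0" using XYZ by blast
  have h: "?h V \<in> VF U"
    by (intro vf_diff vf_scale V(1) xi_vf sf_g[OF U(1)])
  have "g q (?h V q) (\<xi> q) = 0" if "q \<in> U" for q using V(1) that vf_tangent[OF V(1) that] by simp
  from adapted_frame_normalize[OF U(1) h this U(2) V(2)] show ?thesis using that by metis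
qed

end

section \<open>The entries of \<open>h\<close> as connection coefficients\<close>

context adapted_frame
begin

lemma adapted_restrict: "open U' \<Longrightarrow> U' \<subseteq> U \<Longrightarrow> adapted_frame A g D \<phi> \<xi> \<eta> U' e"
  using restrict[of U'] e2 e3 by (intro adapted_frame.intro adapted_frame_axioms.intro contact_manifold_axioms) auto

lemma phi_e:
  assumes "q \<in> U"
  shows "\<phi> q (e 1 q) = e 2 q" "\<phi> q (e 2 q) = - e 1 q" "\<phi> q (e 3 q) = 0"
  using assms e2 e3[symmetric] e3 orthonormal[of q 1 3] by (simp_all add: phi_phi)

lemma phi_expand:
  assumes q: "q \<in> U" and v: "v \<in> T q"
  shows "\<phi> q v = g q v (e 1 q) \<cdot> e 2 q - g q v (e 2 q) \<cdot> e 1 q"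
  by (subst tangent_expand[OF assms]) (simp add: sum_3 phi_add phi_scale q phi_e)

lemma D_xi: "p \<in> U \<Longrightarrow> X \<in> VF U \<Longrightarrow> D X \<xi> p = D X (e 3) p"
  by (rule D_cong[OF U]) (auto simp: e3)

lemma G_contact:
  assumes p: "p \<in> U"
  shows "2 * g p (e i p) (\<phi> p (e j p)) = G i 3 j p - G j 3 i p"
  using phi_D_xi[OF U e e p, of i j] D_tangent[OF U e e p]
  by (simp add: D_xi[OF p] G_def p g_sym[of "D _ _ p"])

text \<open>\<xi> is geodesic because d\<eta>(\<xi>, .) = 0, and the 2 in the last equation is - 2
  d\<eta>(e1, e2).\<close>

lemma G_reeb:
  assumes p: "p \<in> U"
  shows "G 3 1 3 p = 0" "G 3 2 3 p = 0" "G 3 3 1 p = 0" "G 3 3 2 p = 0" "G 2 1 3 p = G 1 2 3 p - 2"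
proof -
  show a: "G 3 3 1 p = 0" "G 3 3 2 p = 0"
    using G_contact[OF p, of 3 1] G_contact[OF p, of 3 2] p by (simp_all add: phi_e orthonormal)
  show "G 3 1 3 p = 0" "G 3 2 3 p = 0"
    using a G_antisym[OF p, of 3 1 3] G_antisym[OF p, of 3 2 3] by auto
  show "G 2 1 3 p = G 1 2 3 p - 2"
    using G_contact[OF p, of 1 2] p G_antisym[OF p, of 1 3 2] G_antisym[OF p, of 2 3 1]
    by (simp add: phi_e orthonormal)
qed

lemma G_swap:
  assumes p: "p \<in> U"
  shows "G i 2 1 p = - G i 1 2 p" "G i 3 1 p = - G i 1 3 p" "G i 3 2 p = - G i 2 3 p"
  using G_antisym[OF p] by blast+

text \<open>This is d(d\<eta>) = 0, read from the \<xi>-component of the Jacobi identity. It says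
  that \<xi> is divergence free, or equivalently that \<open>h\<close> is symmetric.\<close>

lemma G_223:
  assumes p: "p \<in> U"
  shows "G 2 2 3 p = - G 1 1 3 p"
proof -
  have z: "e i p (\<lambda>q. G j 3 3 q - G 3 j 3 q) = 0" "e i p (\<lambda>q. G 3 j 3 q - G j 3 3 q) = 0" if "j \<in> {1, 2}" for i j
    using that G_reeb by (auto intro!: e_const[OF p, of _ 0])
  have z': "e 3 p (\<lambda>q. G 1 2 3 q - G 2 1 3 q) = 0"
    by (rule e_const[OF p, of _ 2]) (simp add: G_reeb)
  show ?thesis
    using jacobi[OF p, of 1 2 3 3]
    by (simp only: sum_3 z z' insertI1 insertI2 G_reeb[OF p] G_swap[OF p] G_same[OF p]) algebra
qed

lemmas G_rules = G_reeb G_swap G_223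

text \<open>The right-hand side is 2 - tr(h h). No derivatives survive, since the coefficients
  \<open>G 3 3 j\<close> vanish and the trace of \<open>G i 3 i\<close> over \<open>i\<close> is
  zero.\<close>

lemma ricci_xi_xi:
  assumes p: "p \<in> U"
  shows "Ric \<xi> \<xi> p = 2 - 2 * (G 1 1 3 p)\<^sup>2 - 2 * (G 1 2 3 p - 1)\<^sup>2"
proof -
  have "Ric \<xi> \<xi> p = Ric (e 3) (e 3) p"
    by (rule ricci_cong) (use p e3 in auto)
  also have "\<dots> = (\<Sum>i\<in>UNIV. g p (R (e i) (e 3) (e 3) p) (e i p))"
    using p by (simp add: ricci_frame[OF U])
  finally have *: "Ric \<xi> \<xi> p = \<dots>" .
  have z: "e i p (G 3 3 j) = 0" for i j
    using exhaust_3[of j] G_reeb by (intro e_const[OF p, of _ 0]) auto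
  have z': "e 3 p (G 2 3 2) = - e 3 p (G 1 3 1)"
    using e_affine[OF p sf_G, of "G 2 3 2" 0 "-1" 1 3 1] by (simp add: G_rules)
  show ?thesis
    unfolding *
    by (simp only: R_frame[OF p] sum_3 z z' G_rules[OF p] G_same[OF p]) algebra
qed

end

section \<open>Change of adapted frame, and the Sasakian condition at a point\<close>

context adapted_frame
begin

text \<open>The derivative term vanishes because \<open>V\<close> has no \<xi>-component, the
  connection term because \<xi> is geodesic.\<close>

lemma lie_deriv_reeb:
  assumes V: "V \<in> VF U" and orth: "\<And>q. q \<in> U \<Longrightarrow> g q (V q) (\<xi> q) = 0" and p: "p \<in> U"
  shows "lie_deriv_metric A g V (e 3) (e 3) p = 0"
proof -
  have "e 3 p (\<lambda>q. g q (V q) (e 3 q)) = 0"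
    by (rule e_const[OF p, of _ 0]) (simp add: e3 orth)
  then show ?thesis
    by (simp only: lie_deriv_frame[OF V p] sum_3 G_reeb[OF p] G_same[OF p]) simp
qed

text \<open>With \<open>x\<close>, \<open>y\<close> the cosine and sine of the rotation, this is how
  1 + g(h u, u) transforms; \<open>2 - G 1 2 3\<close> is its value at \<open>e 2\<close>.\<close>

lemma adapted_change:
  assumes e': "adapted_frame A g D \<phi> \<xi> \<eta> U' e'" and U': "U' \<subseteq> U" and xy: "x \<in> SF U'" "y \<in> SF U'"
    and eq: "\<And>q. q \<in> U' \<Longrightarrow> e' 1 q = x q \<cdot> e 1 q + y q \<cdot> e 2 q" and p: "p \<in> U'"
  shows "g p (D (e' 1) (e' 2) p) (e' 3 p) =
    (x p)\<^sup>2 * G 1 2 3 p + (y p)\<^sup>2 * (2 - G 1 2 3 p) - 2 * x p * y p * G 1 1 3 p"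
proof -
  interpret E: adapted_frame A g D \<phi> \<xi> \<eta> U' e' by (rule e')
  have pU: "p \<in> U" using p U' by blast
  have ev: "e i \<in> VF U'" for i by (rule vf_subset[OF e U'])
  have T: "e i p \<in> T p" "D (e i) (e j) p \<in> T p" for i j using pU D_tangent[OF U e e pU] by auto
  have "D (e' 1) (e' 3) p = D (\<lambda>q. x q \<cdot> e 1 q + y q \<cdot> e 2 q) (e 3) p"
    by (rule D_cong[OF E.U E.e E.e p]) (use eq E.e3 e3 U' in auto)
  also have "\<dots> = x p \<cdot> D (e 1) (e 3) p + y p \<cdot> D (e 2) (e 3) p"
    by (simp only: D_add_left[OF E.U vf_scale[OF ev xy(1)] ev vf_scale[OF ev xy(2)] p]
        D_scale_left[OF E.U ev ev xy(1) p] D_scale_left[OF E.U ev ev xy(2) p])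
  finally have 1: "D (e' 1) (e' 3) p = x p \<cdot> D (e 1) (e 3) p + y p \<cdot> D (e 2) (e 3) p" .
  have 2: "e' 2 p = x p \<cdot> e 2 p - y p \<cdot> e 1 p"
    using E.e2[OF p] eq[OF p] T by (simp add: phi_add phi_scale phi_e[OF pU])
  have "g p (D (e' 1) (e' 2) p) (e' 3 p) = - g p (D (e' 1) (e' 3) p) (e' 2 p)"
    using E.G_antisym[OF p, of 1 2 3] by (simp only: E.G_def)
  also have "\<dots> = - (x p * (x p * G 1 3 2 p - y p * G 1 3 1 p) + y p * (x p * G 2 3 2 p - y p * G 2 3 1 p))"
    unfolding 1 2 G_def using T by (simp add: algebra_simps)
  also have "\<dots> = (x p)\<^sup>2 * G 1 2 3 p + (y p)\<^sup>2 * (2 - G 1 2 3 p) - 2 * x p * y p * G 1 1 3 p"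
    by (simp only: G_rules[OF pU]) algebra
  finally show ?thesis .
qed

text \<open>The first two hypotheses say that h = 0 at \<open>p\<close>, so that \<nabla>_X \<xi> =
  - \<phi> X there. The one free component of the connection, \<open>c\<close> = g(D X e1, e2),
  cancels, and so do the derivatives of the components of \<open>Y\<close>.\<close>

lemma sasakian_at:
  assumes s: "G 1 1 3 p = 0" and t: "G 1 2 3 p = 1" and p: "p \<in> U" and X: "X \<in> VF U" and Y: "Y \<in> VF U"
  shows "D X (\<lambda>q. \<phi> q (Y q)) p - \<phi> p (D X Y p) = g p (X p) (Y p) \<cdot> \<xi> p - \<eta> p (Y p) \<cdot> X p"
proof -
  define x where "x i = g p (X p) (e i p)" for i
  define y where "y i q = g q (Y q) (e i q)" for i q
  have y: "y i \<in> SF U" for i unfolding y_def[abs_def] by (rule sf_comp[OF Y])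
  have T: "X p \<in> T p" "Y p \<in> T p" "D X (e i) p \<in> T p" "e i p \<in> T p" for i
    using X Y p D_tangent[OF U X e p] by auto
  have Xe: "X p = x 1 \<cdot> e 1 p + x 2 \<cdot> e 2 p + x 3 \<cdot> e 3 p"
    using tangent_expand[OF p T(1)] by (simp only: x_def sum_3)
  have Ye: "Y q = (\<Sum>i\<in>UNIV. y i q \<cdot> e i q)" if "q \<in> U" for q
    using tangent_expand[OF that vf_tangent[OF Y that]] by (simp only: y_def)
  define c where "c = x 1 * G 1 1 2 p + x 2 * G 2 1 2 p + x 3 * G 3 1 2 p"
  have DX: "D X (e j) p = x 1 \<cdot> D (e 1) (e j) p + x 2 \<cdot> D (e 2) (e j) p + x 3 \<cdot> D (e 3) (e j) p" for j
  proof -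
    have "D X (e j) p = D (\<lambda>q. \<Sum>i\<in>UNIV. g q (X q) (e i q) \<cdot> e i q) (e j) p"
      by (rule D_cong[OF U X e p]) (use tangent_expand vf_tangent[OF X] in auto)
    also have "\<dots> = (\<Sum>i\<in>UNIV. x i \<cdot> D (e i) (e j) p)"
      using X p by (simp add: D_sum_left[OF U] D_scale_left[OF U] vf_scale x_def)
    finally show ?thesis by (simp only: sum_3)
  qed
  have G213: "G 2 1 3 p = -1" using G_reeb(5)[OF p] t by simp
  note Gs = G_same[OF p] G_swap[OF p] G_reeb(1-4)[OF p] G213 G_223[OF p] s t
  have DX1: "D X (e 1) p = c \<cdot> e 2 p - x 2 \<cdot> e 3 p"
    and DX2: "D X (e 2) p = - (c \<cdot> e 1 p) + x 1 \<cdot> e 3 p"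
    and DX3: "D X (e 3) p = - (x 1 \<cdot> e 2 p) + x 2 \<cdot> e 1 p"
    by (simp_all add: DX D_frame[OF p] sum_3 Gs c_def fun_eq_iff algebra_simps)
  have "D X (\<lambda>q. \<phi> q (Y q)) p = D X (\<lambda>q. y 1 q \<cdot> e 2 q + - (y 2 q \<cdot> e 1 q)) p"
  proof (rule D_cong[OF U X phi_vf[OF U Y] p refl])
    fix q assume q: "q \<in> U"
    show "\<phi> q (Y q) = y 1 q \<cdot> e 2 q + - (y 2 q \<cdot> e 1 q)"
      using phi_expand[OF q vf_tangent[OF Y q]] by (simp add: y_def)
  qed
  also have "\<dots> = X p (y 1) \<cdot> e 2 p + y 1 p \<cdot> D X (e 2) p - (X p (y 2) \<cdot> e 1 p + y 2 p \<cdot> D X (e 1) p)"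
    by (simp only: D_add_right[OF U X vf_scale[OF e y] vf_uminus[OF vf_scale[OF e y]] p]
        D_uminus_right[OF U X vf_scale[OF e y] p] D_scale_right[OF U X e y p] diff_conv_add_uminus)
  finally have 1: "D X (\<lambda>q. \<phi> q (Y q)) p = \<dots>" .
  have "D X Y p = D X (\<lambda>q. \<Sum>i\<in>UNIV. y i q \<cdot> e i q) p"
    by (rule D_cong[OF U X Y p refl Ye])
  also have "\<dots> = (\<Sum>i\<in>UNIV. X p (y i) \<cdot> e i p + y i p \<cdot> D X (e i) p)"
    by (simp only: D_sum_right[OF U vf_scale[OF e y] X p] D_scale_right[OF U X e y p])
  finally have DXY: "D X Y p = \<dots>" .
  have 2: "\<phi> p (D X Y p) = X p (y 1) \<cdot> e 2 p - X p (y 2) \<cdot> e 1 p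
     + y 1 p \<cdot> \<phi> p (D X (e 1) p) + y 2 p \<cdot> \<phi> p (D X (e 2) p) + y 3 p \<cdot> \<phi> p (D X (e 3) p)"
    unfolding DXY sum_3 using T by (simp add: phi_add phi_scale phi_e[OF p])
  have ph: "\<phi> p (D X (e 1) p) = - (c \<cdot> e 1 p)" "\<phi> p (D X (e 2) p) = - (c \<cdot> e 2 p)"
    "\<phi> p (D X (e 3) p) = x 1 \<cdot> e 1 p + x 2 \<cdot> e 2 p"
    using T by (simp_all add: phi_expand[OF p] DX1 DX2 DX3 orthonormal[OF p])
  have gXY: "g p (X p) (Y p) = x 1 * y 1 p + x 2 * y 2 p + x 3 * y 3 p"
    using T unfolding Ye[OF p] by (simp add: sum_3 x_def)
  have eY: "\<eta> p (Y p) = y 3 p" using eta_eq[OF T(2)] e3[OF p] by (simp add: y_def)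
  show ?thesis
    unfolding 1 2 ph gXY eY e3[OF p, symmetric] unfolding DX1 DX2 Xe
    by (simp add: fun_eq_iff algebra_simps)
qed

end

section \<open>Eigenframes of \<open>h\<close> and the soliton equation\<close>

text \<open>The last two assumptions say that \<open>e 1\<close> is an eigenvector of
  \<open>h\<close> with eigenvalue \<mu>.\<close>

locale eigenframe = adapted_frame A g D \<phi> \<xi> \<eta> U e
  for A :: "('a::t2_space, 3) atlas" and g D \<phi> \<xi> \<eta> U e +
  fixes \<mu> :: real
  assumes mu: "\<mu> > 0"
    and G_123: "q \<in> U \<Longrightarrow> G 1 2 3 q = 1 + \<mu>"
    and G_113: "q \<in> U \<Longrightarrow> G 1 1 3 q = 0"

text \<open>
  The eigenvector is \<open>(h + \<mu>) e\<^sub>1\<close>; where it vanishes, \<open>e\<^sub>1\<close> is first replaced by \<open>e\<^sub>2\<close>.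
\<close>

lemma (in contact_manifold) eigenframe_exists:
  assumes mu: "\<mu> > 0"
    and norm: "\<And>U e q. adapted_frame A g D \<phi> \<xi> \<eta> U e \<Longrightarrow> q \<in> U \<Longrightarrow>
      (g q (D (e 1) (e 1) q) (e 3 q))\<^sup>2 + (g q (D (e 1) (e 2) q) (e 3 q) - 1)\<^sup>2 = \<mu>\<^sup>2"
  obtains U e where "p \<in> U" "eigenframe A g D \<phi> \<xi> \<eta> U e \<mu>"
proof -
  obtain U e where pU: "p \<in> U" and af: "adapted_frame A g D \<phi> \<xi> \<eta> U e"
    and ne: "g p (D (e 1) (e 2) p) (e 3 p) - 1 + \<mu> \<noteq> 0"
  proof -
    obtain U e where p: "p \<in> U" and af: "adapted_frame A g D \<phi> \<xi> \<eta> U e" by (rule adapted_frame_exists)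
    show ?thesis
    proof (cases "g p (D (e 1) (e 2) p) (e 3 p) - 1 + \<mu> = 0")
      case False
      then show ?thesis using that p af by blast
    next
      case True
      interpret adapted_frame A g D \<phi> \<xi> \<eta> U e by (rule af)
      \<comment> \<open>Here g(h e1, e1) = - \<mu>. As \<open>h\<close> is trace free, passing to
        \<open>e 2\<close> flips this sign, and the tested quantity becomes 2 \<mu>.\<close>
      let ?e = "\<lambda>i::3. if i = 1 then e 2 else if i = 2 then \<lambda>q. \<phi> q (e 2 q) else \<xi>"
      have af': "adapted_frame A g D \<phi> \<xi> \<eta> U ?e"
        by (rule adapted_frameI) (simp_all add: orthonormal e3[symmetric])
      have "g p (D (?e 1) (?e 2) p) (?e 3 p) = 2 - G 1 2 3 p"
        using adapted_change[OF af' subset_refl sf_const[of 0] sf_const[of 1] _ p] by simp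
      then have "g p (D (?e 1) (?e 2) p) (?e 3 p) - 1 + \<mu> = 2 * \<mu>"
        using True unfolding G_def by linarith
      then have "g p (D (?e 1) (?e 2) p) (?e 3 p) - 1 + \<mu> \<noteq> 0" using mu by linarith
      then show ?thesis using that[OF p af'] by blast
    qed
  qed
  interpret adapted_frame A g D \<phi> \<xi> \<eta> U e by (rule af)
  \<comment> \<open>\<open>?a\<close> is g(h e1, e1) + \<mu> and \<open>?b\<close> is g(h e1,
    e2).\<close>
  let ?a = "\<lambda>q. G 1 2 3 q - 1 + \<mu>" and ?b = "\<lambda>q. - G 1 1 3 q"
  define Y where "Y = (\<lambda>q. ?a q \<cdot> e 1 q + ?b q \<cdot> e 2 q)"
  have a: "?a \<in> SF U" "?b \<in> SF U"
    by (intro sf_add sf_diff sf_uminus sf_const sf_G U)+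
  have Y: "Y \<in> VF U" unfolding Y_def by (intro vf_add vf_scale e a)
  have gYY: "g q (Y q) (Y q) = (?a q)\<^sup>2 + (?b q)\<^sup>2" if "q \<in> U" for q
    using that by (simp add: Y_def orthonormal power2_eq_square)
  have "Y p \<noteq> 0"
  proof
    assume "Y p = 0"
    then have "g p (Y p) (e 1 p) = 0" using pU by simp
    then have "?a p = 0" using pU by (simp add: Y_def orthonormal)
    then show False using ne by (simp add: G_def)
  qed
  moreover have "g q (Y q) (\<xi> q) = 0" if "q \<in> U" for q
    using that by (simp add: Y_def e3[symmetric] orthonormal)
  ultimately obtain U' e' N where U': "p \<in> U'" "U' \<subseteq> U" and af': "adapted_frame A g D \<phi> \<xi> \<eta> U' e'"
    and N: "N \<in> SF U'" "\<And>q. q \<in> U' \<Longrightarrow> (N q)\<^sup>2 * g q (Y q) (Y q) = 1"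
    and e1: "\<And>q. q \<in> U' \<Longrightarrow> e' 1 q = N q \<cdot> Y q"
    using adapted_frame_normalize[OF U Y _ pU] by metis
  interpret E: adapted_frame A g D \<phi> \<xi> \<eta> U' e' by (rule af')
  have 123: "E.G 1 2 3 q = 1 + \<mu>" if q: "q \<in> U'" for q
  proof -
    let ?x = "\<lambda>q. N q * ?a q" and ?y = "\<lambda>q. N q * ?b q"
    have "g q (D (e' 1) (e' 2) q) (e' 3 q) =
      (?x q)\<^sup>2 * G 1 2 3 q + (?y q)\<^sup>2 * (2 - G 1 2 3 q) - 2 * ?x q * ?y q * G 1 1 3 q"
    proof (rule adapted_change[OF af' U'(2) _ _ _ q])
      show "?x \<in> SF U'" "?y \<in> SF U'"
        by (intro sf_mult E.U N(1) sf_subset[OF a(1) U'(2)] sf_subset[OF a(2) U'(2)])+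
      show "e' 1 q = ?x q \<cdot> e 1 q + ?y q \<cdot> e 2 q" if "q \<in> U'" for q
        using e1[OF that] by (simp add: Y_def fun_eq_iff algebra_simps)
    qed
    moreover have "(N q)\<^sup>2 * ((?a q)\<^sup>2 + (?b q)\<^sup>2) = 1"
      using N(2)[OF q] gYY[of q] q U'(2) by auto
    moreover have "(G 1 1 3 q)\<^sup>2 + (G 1 2 3 q - 1)\<^sup>2 = \<mu>\<^sup>2"
      using norm[OF af, of q] q U'(2) by (auto simp: G_def)
    \<comment> \<open>\<open>norm\<close> says that h h = \<mu>^2 on the plane orthogonal to \<xi>,
      hence h Y = \<mu> Y; the algebra checks this for the unit vector N Y.\<close>
    ultimately show ?thesis unfolding E.G_def[of 1 2 3] by algebra
  qed
  have "E.G 1 1 3 q = 0" if q: "q \<in> U'" for q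
    using norm[OF af' q] 123[OF q] by (simp add: E.G_def)
  with 123 mu have "eigenframe A g D \<phi> \<xi> \<eta> U' e' \<mu>" by unfold_locales
  then show ?thesis using that U'(1) by blast
qed

context eigenframe
begin

lemma G_213: "q \<in> U \<Longrightarrow> G 2 1 3 q = \<mu> - 1"
  using G_reeb(5) G_123 by simp

lemma G_223': "q \<in> U \<Longrightarrow> G 2 2 3 q = 0"
  using G_223 G_113 by simp

lemmas G_table = G_same G_swap G_reeb(1-4) G_123 G_113 G_213 G_223'

lemma e_G_3:
  assumes p: "p \<in> U"
  shows "e m p (G i 3 j) = 0" "e m p (G i j 3) = 0"
proof -
  have "G i 3 j q = G i 3 j p" if "q \<in> U" for q
    using exhaust_3[of i] exhaust_3[of j] p that by (auto simp: G_table)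
  then show "e m p (G i 3 j) = 0" by (rule e_const[OF p])
  have "G i j 3 q = G i j 3 p" if "q \<in> U" for q
    using exhaust_3[of i] exhaust_3[of j] p that by (auto simp: G_table)
  then show "e m p (G i j 3) = 0" by (rule e_const[OF p])
qed

text \<open>Every coefficient differentiated here carries an index 3 and is constant, so the result
  is algebraic. As \<mu> is nonzero, these Ricci components detect \<open>G 1 1 2\<close> and
  \<open>G 2 1 2\<close>.\<close>

lemma ricci_13:
  assumes p: "p \<in> U"
  shows "Ric (e 1) (e 3) p = 2 * \<mu> * G 1 1 2 p" "Ric (e 2) (e 3) p = - 2 * \<mu> * G 2 1 2 p"
proof -
  have pp: "p \<in> U \<inter> U" using p by simp
  show "Ric (e 1) (e 3) p = 2 * \<mu> * G 1 1 2 p" "Ric (e 2) (e 3) p = - 2 * \<mu> * G 2 1 2 p"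
    by (simp only: ricci_frame[OF U e e pp] R_frame[OF p] sum_3 e_G_3[OF p] G_table[OF p]; algebra)+
qed

end

text \<open>
  In an eigenframe the vanishing of \<open>Ric(\<xi>, e\<^sub>i)\<close> makes the frame close up to a unimodular Lie algebra
  with the single parameter \<open>G 3 1 2\<close>.
\<close>

locale lie_eigenframe = eigenframe +
  assumes G_112: "q \<in> U \<Longrightarrow> G 1 1 2 q = 0" and G_212: "q \<in> U \<Longrightarrow> G 2 1 2 q = 0"
begin

lemmas G_lie = G_table G_112 G_212

text \<open>In the first two components of the Jacobi identity the only nonconstant structure
  functions are \<open>C 2 3 1\<close> and \<open>C 3 1 2\<close>, each equal to
  \<open>G 3 1 2\<close> plus a constant.\<close>

lemma e_12_G_312:
  assumes p: "p \<in> U"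
  shows "e 1 p (G 3 1 2) = 0" "e 2 p (G 3 1 2) = 0"
proof -
  have z: "e m p (\<lambda>q. C i j l q) = 0" if "(i, j, l) \<in> {(3,1,1), (1,2,1), (2,3,2), (1,2,2)}" for m i j l
    using that by (auto intro!: e_const[OF p, of _ 0] simp: G_lie)
  have z231: "e 1 p (\<lambda>q. C 2 3 1 q) = e 1 p (G 3 1 2)"
    using e_affine[OF p sf_G, of "\<lambda>q. C 2 3 1 q" "1 - \<mu>" 1 3 1 2] by (simp add: G_lie)
  have z312: "e 2 p (\<lambda>q. C 3 1 2 q) = e 2 p (G 3 1 2)"
    using e_affine[OF p sf_G, of "\<lambda>q. C 3 1 2 q" "1 + \<mu>" 1 3 1 2] by (simp add: G_lie)
  show "e 1 p (G 3 1 2) = 0" "e 2 p (G 3 1 2) = 0"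
    using jacobi[OF p, of 1 2 3 1] jacobi[OF p, of 1 2 3 2]
    by (simp_all only: sum_3 z z231 z312 insert_iff simp_thms G_lie[OF p]; algebra)+
qed

lemma e_G:
  assumes p: "p \<in> U"
  shows "e m p (G i j k) = 0"
proof -
  have k12: "e 1 q (G 3 1 2) = 0" "e 2 q (G 3 1 2) = 0" if "q \<in> U" for q
    using e_12_G_312[OF that] by auto
  \<comment> \<open>Because [e1, e2] = 2 e3, vanishing derivatives along \<open>e 1\<close> and
    \<open>e 2\<close> force the one along \<open>e 3\<close> to vanish.\<close>
  have "e 1 p (\<lambda>q. e 2 q (G 3 1 2)) = 0" "e 2 p (\<lambda>q. e 1 q (G 3 1 2)) = 0"
    using e_const[OF p, of _ 0] k12 by auto
  then have "2 * e 3 p (G 3 1 2) = 0"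
    using commutator[OF U subset_refl sf_G p, of 1 2 3 1 2] by (simp add: sum_3 G_lie[OF p] k12[OF p])
  then have 312: "e m p (G 3 1 2) = 0" for m using k12[OF p] exhaust_3[of m] by auto
  then have 321: "e m p (G 3 2 1) = 0" for m
    using e_affine[OF p sf_G, of "G 3 2 1" 0 "-1" 3 1 2] by (simp add: G_lie)
  show ?thesis
  proof (cases "i = 3 \<and> j \<noteq> k \<and> j \<noteq> 3 \<and> k \<noteq> 3")
    case True
    then show ?thesis using 312 321 exhaust_3[of j] exhaust_3[of k] by auto
  next
    case False
    have "G i j k q = G i j k p" if "q \<in> U" for q
      using False exhaust_3[of i] exhaust_3[of j] exhaust_3[of k] p that by (auto simp: G_lie)
    then show ?thesis by (rule e_const[OF p])
  qed
qed

lemma ricci_diag: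
  assumes p: "p \<in> U"
  shows "Ric (e 1) (e 1) p = 2 * (1 - \<mu>) * G 3 1 2 p" "Ric (e 2) (e 2) p = 2 * (1 + \<mu>) * G 3 1 2 p"
    "Ric (e 1) (e 2) p = 0" "Ric (e 3) (e 3) p = 2 - 2 * \<mu>\<^sup>2"
proof -
  have pp: "p \<in> U \<inter> U" using p by simp
  show "Ric (e 1) (e 1) p = 2 * (1 - \<mu>) * G 3 1 2 p" "Ric (e 2) (e 2) p = 2 * (1 + \<mu>) * G 3 1 2 p"
    "Ric (e 1) (e 2) p = 0" "Ric (e 3) (e 3) p = 2 - 2 * \<mu>\<^sup>2"
    by (simp only: ricci_frame[OF U e e pp] R_frame[OF p] sum_3 e_G[OF p] G_lie[OF p]; algebra)+
qed

text \<open>The only nonzero coefficients are \<open>G 1 2 3 = 2\<close> and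
  \<open>G 1 3 2 = - 2\<close>: the connection merely rotates the plane of \<open>e 2\<close> and
  \<open>e 3\<close> along \<open>e 1\<close>, and no bracket has an \<open>e 1\<close>
  component.\<close>

lemma flat_at:
  assumes p: "p \<in> U" and k: "G 3 1 2 p = 0" and mu1: "\<mu> = 1"
  shows "R (e i) (e j) (e k) p = 0"
proof (rule tangent_eqI[OF p])
  show "R (e i) (e j) (e k) p \<in> T p" by (rule R_tangent[OF U e e e p])
  have "\<forall>i j k l. g p (R (e i) (e j) (e k) p) (e l p) = 0"
    unfolding forall_3 R_frame[OF p] sum_3 e_G[OF p] by (simp add: G_lie[OF p] k mu1)
  then show "g p (R (e i) (e j) (e k) p) (e l p) = g p 0 (e l p)" for l
    using p by simp
qed simp

lemma soliton_flat:
  assumes V: "V \<in> VF U" and orth: "\<And>q. q \<in> U \<Longrightarrow> g q (V q) (\<xi> q) = 0"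
    and soliton: "\<And>q i j. q \<in> U \<Longrightarrow>
      Ric (e i) (e j) q + (1/2) * lie_deriv_metric A g V (e i) (e j) q = (if i = j then L q else 0)"
    and ric13: "\<And>q i. q \<in> U \<Longrightarrow> i \<noteq> 3 \<Longrightarrow> Ric (e i) (e 3) q = 0"
    and p: "p \<in> U"
  shows "R (e i) (e j) (e k) p = 0"
proof -
  define f where "f i q = g q (V q) (e i q)" for i q
  define \<kappa> where "\<kappa> = G 3 1 2"
  \<comment> \<open>\<alpha> and \<beta> are the values 2 - 2 \<mu>^2 - Ric(e_i, e_i), for i = 1, 2,
    that the diagonal soliton equations prescribe for the derivative of \<open>f i\<close> along
    \<open>e i\<close>. They are written as \<open>c + d * \<kappa> q\<close> to fit
    \<open>e_affine\<close>.\<close>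
  define \<alpha> where "\<alpha> q = 2 * (1 - \<mu>) * (1 + \<mu>) + - 2 * (1 - \<mu>) * \<kappa> q" for q
  define \<beta> where "\<beta> q = 2 * (1 + \<mu>) * (1 - \<mu>) + - 2 * (1 + \<mu>) * \<kappa> q" for q
  have sf_f: "f i \<in> SF U" for i unfolding f_def[abs_def] by (rule sf_comp[OF V])
  have sf_k: "\<kappa> \<in> SF U" unfolding \<kappa>_def by simp
  have ek: "e i q \<kappa> = 0" if "q \<in> U" for i q unfolding \<kappa>_def by (rule e_G[OF that])
  have f3: "f 3 q = 0" if "q \<in> U" for q using orth[OF that] e3[OF that] by (simp add: f_def)
  have ef3: "e i q (f 3) = 0" if "q \<in> U" for i q by (rule e_const[OF that f3])
  have L: "L q = 2 - 2 * \<mu>\<^sup>2" if q: "q \<in> U" for q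
    using soliton[OF q, of 3 3] by (simp add: lie_deriv_reeb[OF V orth q] ricci_diag[OF q])
  have LD: "lie_deriv_metric A g V (e i) (e k) q = e i q (f k) + e k q (f i)
      + (\<Sum>j\<in>UNIV. f j q * (G i j k q + G k j i q))" if "q \<in> U" for i k q
    unfolding f_def[abs_def] by (rule lie_deriv_frame[OF V that])
  \<comment> \<open>The soliton equations outside the \<xi>\<xi>-component. Only \<psi> = e1 f2
    stays open. The factors \<open>1 *\<close> and \<open>-1 *\<close> produce the shape that
    \<open>e_prod\<close> expects.\<close>
  have \<psi>21: "e 2 q (f 1) = - e 1 q (f 2)" and e1f1: "e 1 q (f 1) = \<alpha> q" and e2f2: "e 2 q (f 2) = \<beta> q"
    and e3f1: "e 3 q (f 1) = (- (1 + \<mu>) + 1 * \<kappa> q) * f 2 q"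
    and e3f2: "e 3 q (f 2) = ((1 - \<mu>) + -1 * \<kappa> q) * f 1 q" if q: "q \<in> U" for q
  proof -
    note S = soliton[OF q, unfolded LD[OF q] sum_3 G_lie[OF q] f3[OF q] ef3[OF q]]
    show "e 2 q (f 1) = - e 1 q (f 2)"
      using S[of 1 2] by (simp add: ricci_diag[OF q] G_lie[OF q])
    show "e 1 q (f 1) = \<alpha> q"
      using S[of 1 1] by (simp add: G_lie[OF q] ricci_diag[OF q] \<alpha>_def \<kappa>_def L[OF q] power2_eq_square algebra_simps)
    show "e 2 q (f 2) = \<beta> q"
      using S[of 2 2] by (simp add: G_lie[OF q] ricci_diag[OF q] \<beta>_def \<kappa>_def L[OF q] power2_eq_square algebra_simps)
    show "e 3 q (f 1) = (- (1 + \<mu>) + 1 * \<kappa> q) * f 2 q"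
      using S[of 1 3] by (simp add: G_lie[OF q] ef3[OF q] ric13[OF q] \<kappa>_def algebra_simps)
    show "e 3 q (f 2) = ((1 - \<mu>) + -1 * \<kappa> q) * f 1 q"
      using S[of 2 3] by (simp add: G_lie[OF q] ef3[OF q] ric13[OF q] \<kappa>_def algebra_simps)
  qed
  have e\<alpha>: "e i q (\<lambda>q. e 1 q (f 1)) = 0" and e\<beta>: "e i q (\<lambda>q. e 2 q (f 2)) = 0" if q: "q \<in> U" for i q
    using e_affine[OF q sf_k e1f1[unfolded \<alpha>_def]] e_affine[OF q sf_k e2f2[unfolded \<beta>_def]] ek[OF q] by simp_all
  have ee3f1: "e i q (\<lambda>q. e 3 q (f 1)) = (- (1 + \<mu>) + 1 * \<kappa> q) * e i q (f 2)"
    and ee3f2: "e i q (\<lambda>q. e 3 q (f 2)) = ((1 - \<mu>) + -1 * \<kappa> q) * e i q (f 1)" if q: "q \<in> U" for i q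
    by (rule e_prod[OF q sf_k sf_f _ ek[OF q]], erule e3f1) (rule e_prod[OF q sf_k sf_f _ ek[OF q]], erule e3f2)
  note com = commutator[OF U subset_refl sf_f, unfolded sum_3]
  have \<psi>: "e 1 q (f 2) = 0" if q: "q \<in> U" for q
  proof -
    \<comment> \<open>The bracket [e3, e1] = (1 + \<mu> + \<kappa>) e2 on \<open>f 1\<close>: the
      terms in \<kappa> cancel, and those in 1 + \<mu> add up.\<close>
    have "(1 + \<mu>) * e 1 q (f 2) = 0"
      using com[OF q, of 3 1 1] unfolding e\<alpha>[OF q] ee3f1[OF q] G_lie[OF q] \<psi>21[OF q] \<kappa>_def by algebra
    then show ?thesis using mu by simp
  qed
  have \<psi>': "e 2 q (f 1) = 0" if q: "q \<in> U" for q using \<psi>21 \<psi> q by simp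
  have e\<psi>: "e i q (\<lambda>q. e 1 q (f 2)) = 0" "e i q (\<lambda>q. e 2 q (f 1)) = 0" if q: "q \<in> U" for i q
    using e_const[OF q \<psi>] e_const[OF q \<psi>'] by auto
  \<comment> \<open>On \<open>f 1\<close> and \<open>f 2\<close> all second derivatives in [e1, e2]
    = 2 e3 now vanish.\<close>
  have e3f: "e 3 q (f 1) = 0" "e 3 q (f 2) = 0" if q: "q \<in> U" for q
    using com[OF q, of 1 2 1] com[OF q, of 1 2 2] by (simp_all add: e\<psi>[OF q] e\<alpha>[OF q] e\<beta>[OF q] G_lie[OF q])
  have ee3f: "e i q (\<lambda>q. e 3 q (f 1)) = 0" "e i q (\<lambda>q. e 3 q (f 2)) = 0" if q: "q \<in> U" for i q
    using e_const[OF q e3f(1)] e_const[OF q e3f(2)] by auto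
  have 1: "(- (1 + \<mu>) + \<kappa> p) * \<beta> p = 0" using ee3f1[OF p, of 2] by (simp add: ee3f[OF p] e2f2[OF p])
  have 2: "(1 - \<mu> - \<kappa> p) * \<alpha> p = 0" using ee3f2[OF p, of 1] by (simp add: ee3f[OF p] e1f1[OF p])
  have 3: "(1 - \<mu> + \<kappa> p) * \<alpha> p = 0"
    using com[OF p, of 2 3 1] by (simp add: ee3f[OF p] e\<psi>[OF p] \<psi>[OF p] \<psi>'[OF p] e3f[OF p] e1f1[OF p] G_lie[OF p] \<kappa>_def)
  have 4: "(1 + \<mu> + \<kappa> p) * \<beta> p = 0"
    using com[OF p, of 3 1 2] by (auto simp: ee3f[OF p] e\<psi>[OF p] \<psi>[OF p] \<psi>'[OF p] e3f[OF p] e2f2[OF p] G_lie[OF p] \<kappa>_def)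
  \<comment> \<open>The factors of \<beta> in 1 and 4 differ by 2 (1 + \<mu>) > 0, so they cannot
    both vanish.\<close>
  have "\<beta> p = 0" using 1 4 mu by auto
  then have "2 * (1 + \<mu>) * (1 - \<mu> - \<kappa> p) = 0" by (simp add: \<beta>_def algebra_simps)
  then have k: "\<kappa> p = 1 - \<mu>" using mu by simp
  \<comment> \<open>For \<kappa> = 1 - \<mu> equation 3 reads 2 (1 - \<mu>) \<alpha> = 0, and
    \<alpha> itself contains the factor 1 - \<mu>.\<close>
  have "\<alpha> p = 0" using 2 3 k by (auto simp: \<alpha>_def)
  then have "4 * (1 - \<mu>) * \<mu> = 0" by (simp add: \<alpha>_def k algebra_simps)
  then have "\<mu> = 1" using mu by simp
  then show ?thesis using flat_at[OF p] k by (simp add: \<kappa>_def)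
qed

end

section \<open>From the local eigenframes to the global statement\<close>

theorem theorem3p10:
  fixes A :: "('a::{t2_space, second_countable_topology}, 3) atlas"
    and \<phi> :: "'a \<Rightarrow> 'a tvec \<Rightarrow> 'a tvec"
    and \<xi> :: "'a vfield"
    and \<eta> :: "'a \<Rightarrow> 'a tvec \<Rightarrow> real"
    and g :: "'a \<Rightarrow> 'a tvec \<Rightarrow> 'a tvec \<Rightarrow> real"
    and D :: "'a vfield \<Rightarrow> 'a vfield \<Rightarrow> 'a vfield"
    and V :: "'a vfield"
    and l :: "'a \<Rightarrow> real"
    and \<sigma> \<rho> :: real
  assumes "smooth_atlas A"
    and "connected (UNIV :: 'a set)"
    and "contact_metric_3 A \<phi> \<xi> \<eta> g"
    and "complete_riemannian A g"
    and "levi_civita A g D"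
    and "\<not> sasakian A \<phi> \<xi> \<eta> g D"
    and "\<forall>p. ricci_operator A g D \<xi> p = \<sigma> \<cdot> \<xi> p"
    and "almost_RB_soliton A g D V l \<rho>"
    and "\<forall>p. g p (V p) (\<xi> p) = 0"
  shows "(\<forall>p. l p + \<rho> * scalar_curvature A g D p = \<sigma>) \<and>
         (\<exists>c. \<forall>p. l p = c) \<and>
         RB_soliton A g D V l \<rho> \<and>
         einstein A g D \<and>
         ((\<exists>p. V p \<noteq> 0) \<longrightarrow> flat A D)"
proof -
  interpret contact_manifold A g D \<phi> \<xi> \<eta>
    using assms(1,3,5) by unfold_locales (auto simp: contact_metric_3_def)
  let ?r = "scalar_curvature A g D"
  have V: "V \<in> VF U" for U using assms(8) vf_subset[of V UNIV U] by (simp add: almost_RB_soliton_def)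
  have soliton: "Ric X Y p + (1/2) * lie_deriv_metric A g V X Y p = (l p + \<rho> * ?r p) * g p (X p) (Y p)"
    if "open U" "X \<in> VF U" "Y \<in> VF U" "p \<in> U" for U X Y p
    using assms(8) that unfolding almost_RB_soliton_def by blast
  have ric_xi: "Ric \<xi> Y p = \<sigma> * g p (\<xi> p) (Y p)" if W: "open W" "Y \<in> VF W" "p \<in> W" for W Y p
  proof -
    obtain U e where F: "p \<in> U" "adapted_frame A g D \<phi> \<xi> \<eta> U e" by (rule adapted_frame_exists)
    interpret adapted_frame A g D \<phi> \<xi> \<eta> U e by (rule F(2))
    show ?thesis
      using ricci_operator_spec[of W \<xi> Y p] assms(7) W F(1) vf_tangent[of Y W p] by simp
  qed
  have norm: "(g q (D (e 1) (e 1) q) (e 3 q))\<^sup>2 + (g q (D (e 1) (e 2) q) (e 3 q) - 1)\<^sup>2 = 1 - \<sigma> / 2"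
    if "adapted_frame A g D \<phi> \<xi> \<eta> U e" "q \<in> U" for U e q
  proof -
    interpret adapted_frame A g D \<phi> \<xi> \<eta> U e by (rule that(1))
    show ?thesis
      using ricci_xi_xi[OF that(2)] ric_xi[OF open_UNIV xi_vf UNIV_I, of q] unfolding G_def xi_unit by linarith
  qed
  \<comment> \<open>Otherwise \<open>norm\<close> bounds a sum of squares by 0, so h = 0 at every
    point and the structure is Sasakian.\<close>
  have "\<sigma> < 2"
  proof (rule ccontr)
    assume \<sigma>: "\<not> \<sigma> < 2"
    have "D X (\<lambda>q. \<phi> q (Y q)) p - \<phi> p (D X Y p) = g p (X p) (Y p) \<cdot> \<xi> p - \<eta> p (Y p) \<cdot> X p"
      if W: "open W" "X \<in> VF W" "Y \<in> VF W" "p \<in> W" for W X Y p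
    proof -
      obtain U e where F: "p \<in> U" "adapted_frame A g D \<phi> \<xi> \<eta> U e" by (rule adapted_frame_exists)
      interpret U: adapted_frame A g D \<phi> \<xi> \<eta> U e by (rule F(2))
      interpret adapted_frame A g D \<phi> \<xi> \<eta> "U \<inter> W" e
        by (rule U.adapted_restrict) (use W in \<open>auto simp: open_Int\<close>)
      have "(G 1 1 3 p)\<^sup>2 + (G 1 2 3 p - 1)\<^sup>2 \<le> 0"
        using norm[OF F(2,1)] \<sigma> by (simp add: G_def)
      then have "G 1 1 3 p = 0 \<and> G 1 2 3 p - 1 = 0"
        using sum_power2_le_zero_iff by blast
      then show ?thesis
        using W F(1) vf_subset[of _ W "U \<inter> W"] by (intro sasakian_at) auto
    qed
    then show False using assms(6) unfolding sasakian_def by blast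
  qed
  define \<mu> where "\<mu> = sqrt (1 - \<sigma> / 2)"
  have mu: "\<mu> > 0" "\<mu>\<^sup>2 = 1 - \<sigma> / 2" using \<open>\<sigma> < 2\<close> by (simp_all add: \<mu>_def)
  have flat: "R X Y Z p = 0"
    if W: "open W" "X \<in> VF W" "Y \<in> VF W" "Z \<in> VF W" "p \<in> W" for W X Y Z p
  proof -
    obtain U e where F: "p \<in> U" "eigenframe A g D \<phi> \<xi> \<eta> U e \<mu>"
      using eigenframe_exists[OF mu(1), of p] norm mu(2) by metis
    interpret eigenframe A g D \<phi> \<xi> \<eta> U e \<mu> by (rule F(2))
    have sol: "Ric (e i) (e j) q + (1/2) * lie_deriv_metric A g V (e i) (e j) q =
        (if i = j then l q + \<rho> * ?r q else 0)" if "q \<in> U" for i j q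
      using soliton[OF U e e that] orthonormal[OF that] by simp
    \<comment> \<open>Symmetry of \<open>Ric\<close> is read off the soliton equation, whose other
      terms are symmetric, instead of being derived from the symmetries of the curvature. It is
      needed because \<open>ric_xi\<close> has \<xi> in the first slot and \<open>ricci_13\<close>
      in the second.\<close>
    have sym: "Ric (e i) (e j) q = Ric (e j) (e i) q" if q: "q \<in> U" for i j q
    proof -
      have "lie_deriv_metric A g V (e i) (e j) q = lie_deriv_metric A g V (e j) (e i) q"
        using q D_tangent[OF U e V q] by (simp add: lie_deriv_metric_D[OF U V e e q] g_sym[of "e _ q"])
      then show ?thesis using sol[OF q, of i j] sol[OF q, of j i] by (cases "i = j") simp_all
    qed
    have ric13: "Ric (e i) (e 3) q = 0" if q: "q \<in> U" and i: "i \<noteq> 3" for i q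
    proof -
      have "Ric (e 3) (e i) q = Ric \<xi> (e i) q"
        by (rule ricci_cong) (use q e3 in auto)
      also have "\<dots> = 0"
        using ric_xi[OF U e q, of i] orthonormal[OF q, of 3 i] e3[OF q] i by simp
      finally show ?thesis using sym[OF q] by simp
    qed
    interpret lie_eigenframe A g D \<phi> \<xi> \<eta> U e \<mu>
      by unfold_locales (use ricci_13 ric13 mu(1) in auto)
    have R0: "R (e i) (e j) (e k) p = 0" for i j k
      by (rule soliton_flat[OF V _ sol ric13 F(1)]) (use assms(9) in auto)
    have "orthonormal_frame A g D (U \<inter> W) e"
      by (rule restrict) (use W in \<open>auto simp: open_Int\<close>)
    then show ?thesis
      by (rule orthonormal_frame.R_zeroI[OF _ W(2-4)[THEN vf_subset[OF _ Int_lower2]] _ R0]) (use W F(1) in simp)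
  qed
  have ric0: "Ric X Y p = 0" if W: "open W" "X \<in> VF W" "Y \<in> VF W" "p \<in> W" for W X Y p
  proof -
    obtain U e where F: "p \<in> U" "adapted_frame A g D \<phi> \<xi> \<eta> U e" by (rule adapted_frame_exists)
    interpret adapted_frame A g D \<phi> \<xi> \<eta> U e by (rule F(2))
    have "R (e i) X Y p = 0" for i
      using flat[of "U \<inter> W" "e i" X Y p] W F(1) vf_subset[of _ W "U \<inter> W"] vf_subset[OF e, of "U \<inter> W"]
      by (auto simp: open_Int)
    then show ?thesis using ricci_frame[of W X Y p] W F(1) by simp
  qed
  have sigma0: "\<sigma> = 0" using ric_xi[of UNIV \<xi>] ric0[of UNIV \<xi> \<xi>] by simp
  \<comment> \<open>Once \<open>Ric\<close> vanishes, so does the scalar curvature, and the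
    \<xi>\<xi>-component of the soliton equation leaves \<open>l p = 0\<close>.\<close>
  have r0: "?r p = 0" and l0: "l p = 0" for p
  proof -
    obtain U e where F: "p \<in> U" "adapted_frame A g D \<phi> \<xi> \<eta> U e" by (rule adapted_frame_exists)
    interpret adapted_frame A g D \<phi> \<xi> \<eta> U e by (rule F(2))
    obtain U' where U': "p \<in> U'" "orthonormal_frame A g D U' (SOME E. orthonormal_frame_at A g p E)"
      using some_frame[OF F(1)] .
    interpret E: orthonormal_frame A g D U' "SOME E. orthonormal_frame_at A g p E" by (rule U'(2))
    show r: "?r p = 0"
      unfolding scalar_curvature_def Let_def using ric0[OF E.U E.e E.e U'(1)] by simp
    show "l p = 0"
      using soliton[OF U e e F(1), of 3 3] lie_deriv_reeb[OF V _ F(1)] assms(9) ric0[OF U e e F(1)]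
        orthonormal[OF F(1), of 3 3] r by simp
  qed
  \<comment> \<open>The constant value of \<open>l\<close> and the Einstein constant are both 0, and
    \<lambda> + \<rho> r = \<sigma> has become 0 = 0.\<close>
  show ?thesis
    using r0 l0 sigma0 ric0 flat assms(8) by (auto simp: RB_soliton_def einstein_def flat_def intro!: exI[of _ 0])
qed

end
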